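(* Let $\alpha\in\mathbb{R}$ with $\alpha\ge2$ and $\alpha\ne24$, and let $n,\ell$ be positive integers with $n>\ell$ and $(\alpha,n,\ell)\neq(2,6,4)$. If $$\ell\ \ge\ \max\left\{2\alpha^{11}+\frac{\alpha}{24},\ \frac{100}{\alpha-24}+\frac{\alpha}{24}\right\},$$ then $$p_\alpha(n-1)\,p_\alpha(\ell+1)\ \ge\ p_\alpha(n)\,p_\alpha(\ell).$$
   Context: For real $\alpha>0$, the numbers $p_\alpha(n)$ ($n\ge 0$) are defined by $\prod_{m\ge1}(1-q^m)^{-\alpha}=\sum_{n\ge0}p_\alpha(n)q^n$ (for $|q|<1$, with the branch having constant term $1$). *)

theory Defs
  imports "HOL-Complex_Analysis.Complex_Analysis"
begin

text \<open>
  Library infinite products start at 0, so the factor for \<open>m \<ge> 1\<close> appears with \<open>Suc m\<close>.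
  For \<open>|q| < 1\<close> the number \<open>1 - q ^ m\<close> has positive real part, so the principal branch used by
  \<open>powr\<close> is the analytic branch equal to 1 at \<open>q = 0\<close>.
\<close>

definition frac_partition_gf :: "real \<Rightarrow> complex \<Rightarrow> complex" where
  "frac_partition_gf \<alpha> q = (\<Prod>m. (1 - q ^ Suc m) powr (- complex_of_real \<alpha>))"

definition frac_partition :: "real \<Rightarrow> nat \<Rightarrow> real" where
  "frac_partition \<alpha> =
     (THE c. \<forall>q::complex. norm q < 1 \<longrightarrow>
        (\<lambda>n. complex_of_real (c n) * q ^ n) sums frac_partition_gf \<alpha> q)"

text \<open>
  The remaining lemmas show that both definitions are meaningful: the product converges, and there
  is exactly one real coefficient sequence.
\<close>

lemma Re_one_minus_power_pos:
  assumes "norm (q::complex) < 1"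
  shows "Re (1 - q ^ Suc m) > 0"
proof -
  have "norm (q ^ Suc m) < 1"
    using power_decreasing[of 1 "Suc m" "norm q"] assms by (simp add: norm_power del: power_Suc)
  then show ?thesis
    using complex_Re_le_cmod[of "q ^ Suc m"] by simp
qed

lemma eventually_norm_Ln_one_minus_power_le:
  fixes r :: real
  assumes "0 \<le> r" "r < 1"
  shows "eventually (\<lambda>m. \<forall>q\<in>cball 0 r. norm (Ln (1 - q ^ Suc m :: complex)) \<le> 2 * r ^ Suc m)
           sequentially"
proof -
  have "(\<lambda>m. r ^ Suc m) \<longlonglongrightarrow> 0"
    using assms by (intro LIMSEQ_Suc LIMSEQ_power_zero) auto
  then have "eventually (\<lambda>m. r ^ Suc m < 1/2) sequentially"
    by (rule order_tendstoD) auto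
  then show ?thesis
  proof eventually_elim
    case (elim m)
    show ?case
    proof
      fix q :: complex assume "q \<in> cball 0 r"
      then have le: "norm (q ^ Suc m) \<le> r ^ Suc m"
        unfolding norm_power by (intro power_mono) auto
      then have "norm (Ln (1 + (- (q ^ Suc m)))) \<le> 2 * norm (- (q ^ Suc m))"
        using elim by (intro norm_Ln_le) simp
      then show "norm (Ln (1 - q ^ Suc m)) \<le> 2 * r ^ Suc m"
        using le by simp
    qed
  qed
qed

lemma summable_two_power_Suc: "0 \<le> r \<Longrightarrow> r < 1 \<Longrightarrow> summable (\<lambda>m. 2 * r ^ Suc m :: real)"
  using summable_mult[OF summable_geometric[of r], of "2 * r"] by (simp add: mult.assoc)

lemma summable_Ln_one_minus_power:
  assumes "norm (q::complex) < 1"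
  shows "summable (\<lambda>m. Ln (1 - q ^ Suc m))"
proof (rule summable_comparison_test_ev)
  show "eventually (\<lambda>m. norm (Ln (1 - q ^ Suc m)) \<le> 2 * norm q ^ Suc m) sequentially"
    using eventually_norm_Ln_one_minus_power_le[of "norm q"] assms
    by (auto elim!: eventually_mono)
qed (use assms in \<open>auto intro!: summable_two_power_Suc\<close>)

lemma frac_partition_factor_eq:
  assumes "norm (q::complex) < 1"
  shows "(1 - q ^ Suc m) powr (- complex_of_real \<alpha>) = exp (- of_real \<alpha> * Ln (1 - q ^ Suc m))"
proof -
  have "1 - q ^ Suc m \<noteq> 0"
    using Re_one_minus_power_pos[OF assms, of m] by (metis less_irrefl zero_complex.sel(1))
  then show ?thesis
    by (simp add: powr_def)
qed

lemma convergent_prod_frac_partition: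
  assumes "norm (q::complex) < 1"
  shows "convergent_prod (\<lambda>m. (1 - q ^ Suc m) powr (- complex_of_real \<alpha>))"
  unfolding frac_partition_factor_eq[OF assms]
  by (intro convergent_prod_exp summable_mult summable_Ln_one_minus_power assms)

lemma frac_partition_gf_eq_exp:
  assumes "norm (q::complex) < 1"
  shows "frac_partition_gf \<alpha> q = exp (- of_real \<alpha> * (\<Sum>m. Ln (1 - q ^ Suc m)))"
  unfolding frac_partition_gf_def frac_partition_factor_eq[OF assms]
  using prodinf_exp[OF summable_mult[OF summable_Ln_one_minus_power[OF assms]], of "- of_real \<alpha>"]
    suminf_mult[OF summable_Ln_one_minus_power[OF assms], of "- of_real \<alpha>"]
  by simp

lemma holomorphic_suminf_Ln_one_minus_power:
  "(\<lambda>q::complex. \<Sum>m. Ln (1 - q ^ Suc m)) holomorphic_on ball 0 1"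
proof (rule holomorphic_uniform_sequence)
  show "(\<lambda>q::complex. \<Sum>m<n. Ln (1 - q ^ Suc m)) holomorphic_on ball 0 1" for n
  proof (intro holomorphic_intros)
    show "1 - q ^ Suc m \<notin> \<real>\<^sub>\<le>\<^sub>0" if "q \<in> ball 0 1" for q :: complex and m
      using Re_one_minus_power_pos[of q m] that by (auto simp: complex_nonpos_Reals_iff)
  qed
  fix q :: complex assume q: "q \<in> ball 0 1"
  define d where "d = (1 - norm q) / 2"
  define r where "r = norm q + d"
  have r: "0 \<le> r" "r < 1" "0 < d"
    using q by (auto simp: d_def r_def field_simps)
  have sub: "cball q d \<subseteq> cball 0 r"
  proof
    fix x assume "x \<in> cball q d"
    then have "norm (x - q) \<le> d"
      by (simp add: dist_norm norm_minus_commute)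
    then show "x \<in> cball 0 r"
      using norm_triangle_ineq[of q "x - q"] by (simp add: r_def)
  qed
  have "uniform_limit (cball q d) (\<lambda>n q. \<Sum>m<n. Ln (1 - q ^ Suc m)) (\<lambda>q. \<Sum>m. Ln (1 - q ^ Suc m))
          sequentially"
    using eventually_norm_Ln_one_minus_power_le[OF r(1,2)] sub
    by (intro Weierstrass_m_test_ev[where M = "\<lambda>m. 2 * r ^ Suc m"] summable_two_power_Suc r)
       (auto elim!: eventually_mono)
  then show "\<exists>d>0. cball q d \<subseteq> ball 0 1 \<and>
      uniform_limit (cball q d) (\<lambda>n q. \<Sum>m<n. Ln (1 - q ^ Suc m))
        (\<lambda>q. \<Sum>m. Ln (1 - q ^ Suc m)) sequentially"
    using r sub by (intro exI[of _ d]) force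
qed auto

lemma holomorphic_frac_partition_gf: "frac_partition_gf \<alpha> holomorphic_on ball 0 1"
proof -
  have "(\<lambda>q. exp (- of_real \<alpha> * (\<Sum>m. Ln (1 - q ^ Suc m)))) holomorphic_on ball 0 1"
    by (intro holomorphic_intros holomorphic_suminf_Ln_one_minus_power)
  then show ?thesis
    by (rule holomorphic_transform) (simp add: frac_partition_gf_eq_exp)
qed

lemma powser_coeffs_eq:
  fixes a b :: "nat \<Rightarrow> complex"
  assumes "\<And>q. norm q < 1 \<Longrightarrow> (\<lambda>n. a n * q ^ n) sums f q"
    and "\<And>q. norm q < 1 \<Longrightarrow> (\<lambda>n. b n * q ^ n) sums f q"
  shows "a = b"
proof -
  have *: "f has_fps_expansion Abs_fps c"
    if c: "\<And>q. norm q < 1 \<Longrightarrow> (\<lambda>n. c n * q ^ n) sums f q" for c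
    unfolding has_fps_expansion_def
  proof
    have "conv_radius c \<ge> norm (1/2 :: complex)"
      by (rule conv_radius_geI) (use c[of "1/2"] in \<open>auto simp: sums_iff\<close>)
    then show "fps_conv_radius (Abs_fps c) > 0"
      unfolding fps_conv_radius_def by (auto intro: less_le_trans[rotated])
    have "eventually (\<lambda>z. z \<in> ball (0::complex) 1) (nhds 0)"
      by (intro eventually_nhds_in_open) auto
    then show "eventually (\<lambda>z. eval_fps (Abs_fps c) z = f z) (nhds 0)"
      by eventually_elim (use c in \<open>auto simp: eval_fps_def sums_iff\<close>)
  qed
  have "Abs_fps a = Abs_fps b"
    by (rule fps_expansion_unique_complex[of f]) (intro * assms; assumption)+
  then have "fps_nth (Abs_fps a) = fps_nth (Abs_fps b)"
    by (simp only:)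
  then show ?thesis
    by (simp add: fun_eq_iff)
qed

lemma frac_partition_gf_cnj:
  assumes "norm q < 1"
  shows "frac_partition_gf \<alpha> (cnj q) = cnj (frac_partition_gf \<alpha> q)"
proof -
  have *: "Ln (1 - cnj q ^ Suc m) = cnj (Ln (1 - q ^ Suc m))" for m
    using Re_one_minus_power_pos[OF assms, of m]
    by (subst cnj_Ln) (auto simp: complex_nonpos_Reals_iff)
  have "(\<lambda>m. cnj (Ln (1 - q ^ Suc m))) sums cnj (\<Sum>m. Ln (1 - q ^ Suc m))"
    unfolding sums_cnj using summable_Ln_one_minus_power[OF assms] by (rule summable_sums)
  then have "(\<Sum>m. Ln (1 - cnj q ^ Suc m)) = cnj (\<Sum>m. Ln (1 - q ^ Suc m))"
    unfolding * by (rule sums_unique[symmetric])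
  then show ?thesis
    using assms by (simp add: frac_partition_gf_eq_exp exp_cnj del: power_Suc)
qed

lemma frac_partition_exists_unique:
  "\<exists>!c::nat \<Rightarrow> real. \<forall>q::complex. norm q < 1 \<longrightarrow>
     (\<lambda>n. complex_of_real (c n) * q ^ n) sums frac_partition_gf \<alpha> q"
proof -
  define a where "a = (\<lambda>n. (deriv ^^ n) (frac_partition_gf \<alpha>) 0 / fact n)"
  have a: "(\<lambda>n. a n * q ^ n) sums frac_partition_gf \<alpha> q" if "norm q < 1" for q
    using holomorphic_power_series[OF holomorphic_frac_partition_gf, of q \<alpha>] that
    by (simp add: a_def)
  have "(\<lambda>n. cnj (a n) * q ^ n) sums frac_partition_gf \<alpha> q" if "norm q < 1" for q
  proof -
    have "(\<lambda>n. cnj (a n * cnj q ^ n)) sums cnj (frac_partition_gf \<alpha> (cnj q))"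
      unfolding sums_cnj using that by (intro a) simp
    then show ?thesis
      using frac_partition_gf_cnj[OF that] by simp
  qed
  then have "(\<lambda>n. cnj (a n)) = a"
    using a by (intro powser_coeffs_eq[where f = "frac_partition_gf \<alpha>"])
  then have real: "complex_of_real (Re (a n)) = a n" for n
    by (metis Reals_cnj_iff of_real_Re)
  show ?thesis
  proof (rule ex1I[of _ "\<lambda>n. Re (a n)"])
    show "\<forall>q. norm q < 1 \<longrightarrow> (\<lambda>n. complex_of_real (Re (a n)) * q ^ n) sums frac_partition_gf \<alpha> q"
      using a by (simp add: real)
  next
    fix c :: "nat \<Rightarrow> real"
    assume "\<forall>q. norm q < 1 \<longrightarrow> (\<lambda>n. complex_of_real (c n) * q ^ n) sums frac_partition_gf \<alpha> q"
    then have "(\<lambda>n. complex_of_real (c n)) = a"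
      using a by (intro powser_coeffs_eq[where f = "frac_partition_gf \<alpha>"]) auto
    then show "c = (\<lambda>n. Re (a n))"
      by (simp add: \<open>(\<lambda>n. complex_of_real (c n)) = a\<close>[symmetric])
  qed
qed

theorem frac_partition_sums:
  fixes q :: complex
  assumes "norm q < 1"
  shows "(\<lambda>n. complex_of_real (frac_partition \<alpha> n) * q ^ n) sums
           (\<Prod>m. (1 - q ^ Suc m) powr (- complex_of_real \<alpha>))"
proof -
  have "\<forall>q::complex. norm q < 1 \<longrightarrow>
      (\<lambda>n. complex_of_real (frac_partition \<alpha> n) * q ^ n) sums frac_partition_gf \<alpha> q"
    unfolding frac_partition_def by (rule theI'[OF frac_partition_exists_unique])
  from this[rule_format, OF assms] show ?thesis
    by (simp only: frac_partition_gf_def)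
qed

end

theory Submission
  imports Defs
begin

text \<open>
  It suffices to show that \<open>p\<^sub>\<alpha>\<close> is log-concave at every \<open>n \<ge> 2 \<alpha>^11\<close>. By the inequality of arithmetic and
  geometric means this holds at \<open>n\<close> as soon as \<open>2 w n \<ge> w (n - 1) + w (n + 1)\<close> for the weights
  \<open>w k = p\<^sub>\<alpha>(k) r^k\<close> with some \<open>r > 0\<close>, that is, as soon as the integral over \<open>0 \<le> u \<le> \<pi>\<close> of
  \<open>Re (F (r e^(iu)) e^(-inu)) (1 - cos u)\<close> is nonnegative, where \<open>F = exp (\<alpha> \<Sum> b k q^k)\<close> is the generating
  function and \<open>b k\<close> is the sum of the reciprocals of the divisors of \<open>k\<close>. Let \<open>r = e^(-t)\<close> be the saddle
  point \<open>\<alpha> \<Sum> k b k r^k = n\<close>. Then the phase of the integrand is only of third order in \<open>u\<close>, so the integrand is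
  positive near 0, and for larger \<open>u\<close> the bound \<open>b k \<ge> 1\<close> compares \<open>\<bar>F (r e^(iu))\<bar> / F r\<close> with an explicit geometric
  series. Hence no modular transformation of \<open>F\<close> is needed.
\<close>

section \<open>Moments of the divisor sums\<close>

text \<open>This is sigma(n)/n: collecting the terms q^(m k)/k of the sum over m of -log (1 - q^m)
  with m k = n leaves 1/k for each divisor k of n.\<close>

definition sigma_inv :: "nat \<Rightarrow> real" where
  "sigma_inv n = (\<Sum>k | k dvd n. 1 / real k)"

text \<open>The divisors of 0 form an infinite set, so the sum is 0 by convention.\<close>

lemma sigma_inv_0 [simp]: "sigma_inv 0 = 0"
  by (simp add: sigma_inv_def)

lemma sigma_inv_nonneg: "0 \<le> sigma_inv n"
  unfolding sigma_inv_def by (intro sum_nonneg) auto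

lemma sigma_inv_ge_1:
  assumes "n > 0"
  shows "1 \<le> sigma_inv n"
proof -
  have "(\<Sum>k\<in>{1}. 1 / real k) \<le> sigma_inv n"
    unfolding sigma_inv_def using assms by (intro sum_mono2) auto
  then show ?thesis by simp
qed

text \<open>The map (n, k) -> (k, n div k) is injective on pairs with k dividing n, and for n in
  {1..M} it lands in the square {1..M} x {1..M}. The terms of the square that are missed are
  nonnegative.\<close>

lemma sum_divisors_le_sum_square:
  fixes g :: "nat \<Rightarrow> nat \<Rightarrow> real"
  assumes "\<And>k m. g k m \<ge> 0"
  shows "(\<Sum>n=1..M. \<Sum>k | k dvd n. g k (n div k)) \<le> (\<Sum>k=1..M. \<Sum>m=1..M. g k m)"
proof -
  have "(\<Sum>n=1..M. \<Sum>k | k dvd n. g k (n div k))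
      = (\<Sum>(n, k)\<in>(SIGMA n:{1..M}. {k. k dvd n}). g k (n div k))"
    by (rule sum.Sigma) auto
  also have "\<dots> = (\<Sum>p\<in>(SIGMA n:{1..M}. {k. k dvd n}).
      (\<lambda>(k, m). g k m) ((\<lambda>(n, k). (k, n div k)) p))"
    by (simp add: case_prod_beta)
  also have "\<dots> = sum (\<lambda>(k, m). g k m) ((\<lambda>(n, k). (k, n div k)) ` (SIGMA n:{1..M}. {k. k dvd n}))"
    by (rule sum.reindex[symmetric, unfolded o_def]) (auto simp: inj_on_def)
  also have "\<dots> \<le> sum (\<lambda>(k, m). g k m) ({1..M} \<times> {1..M})"
  proof (rule sum_mono2)
    show "(\<lambda>(n, k). (k, n div k)) ` (SIGMA n:{1..M}. {k. k dvd n}) \<subseteq> {1..M} \<times> {1..M}"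
    proof clarsimp
      fix n k :: nat assume "Suc 0 \<le> n" "n \<le> M" "k dvd n"
      moreover from this have "k \<le> n" "0 < k" by (auto intro: dvd_imp_le Nat.gr0I)
      ultimately show "Suc 0 \<le> k \<and> k \<le> M \<and> Suc 0 \<le> n div k \<and> n div k \<le> M"
        by (auto simp: Suc_le_eq div_greater_zero_iff intro: order_trans[OF div_le_dividend])
    qed
  qed (use assms in auto)
  finally show ?thesis
    by (simp add: sum.cartesian_product)
qed

text \<open>Telescoping with 1/k^2 \<le> 1/(k - 1/2) - 1/(k + 1/2), started at M = 2, where 5/4 =
  33/20 - 2/5 holds exactly. The value 33/20 lies just above zeta(2) = 1.6449...\<close>

lemma sum_inverse_squares_le: "(\<Sum>k=1..M. 1 / real k ^ 2) \<le> 33 / 20"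
proof -
  have "M \<ge> 2 \<Longrightarrow> (\<Sum>k=1..M. 1 / real k ^ 2) \<le> 33 / 20 - 2 / (2 * real M + 1)"
  proof (induction M rule: dec_induct)
    case base
    then show ?case by (simp add: numeral_2_eq_2)
  next
    case (step M)
    have "1 / real (Suc M) ^ 2 \<le> 2 / (2 * real M + 1) - 2 / (2 * real (Suc M) + 1)"
      by (simp add: divide_simps power2_eq_square) (simp add: algebra_simps)
    with step.IH show ?case by simp
  qed
  moreover have "0 < 2 / (2 * real M + 1)" by simp
  moreover have "(\<Sum>k=1..M. 1 / real k ^ 2) \<le> 33 / 20" if "\<not> M \<ge> 2"
  proof -
    from that have "M = 0 \<or> M = 1" by auto
    then show ?thesis by auto
  qed
  ultimately show ?thesis by (cases "M \<ge> 2") linarith+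
qed

text \<open>With n = k m the moment becomes a double sum of k^(j-1) m^j exp(-t k m). The hypothesis
  at s = k t bounds the sum over m by C/(k t)^(j+1), so the powers of k collapse to 1/k^2 whatever j
  is.\<close>

lemma sum_power_sigma_inv_exp_le:
  fixes C t :: real
  assumes "\<And>s M. s > 0 \<Longrightarrow> (\<Sum>m=1..M. real m ^ j * exp (- s) ^ m) \<le> C / s ^ Suc j"
    and "t > 0" "C \<ge> 0" "j > 0"
  shows "(\<Sum>n<M. real n ^ j * sigma_inv n * exp (- t) ^ n) \<le> 33 / 20 * C / t ^ Suc j"
proof -
  define g where "g k m = 1 / real k * (real k * real m) ^ j * (exp (- t) ^ k) ^ m" for k m :: nat
  have "(\<Sum>n<M. real n ^ j * sigma_inv n * exp (- t) ^ n)
      \<le> (\<Sum>n\<in>{..M}. real n ^ j * sigma_inv n * exp (- t) ^ n)"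
    by (intro sum_mono2) (auto simp: sigma_inv_nonneg)
  also have "\<dots> = (\<Sum>n=1..M. real n ^ j * sigma_inv n * exp (- t) ^ n)"
    by (intro sum.mono_neutral_right) (auto simp: not_le)
  also have "\<dots> = (\<Sum>n=1..M. \<Sum>k | k dvd n. g k (n div k))"
  proof (rule sum.cong[OF refl])
    fix n assume "n \<in> {1..M}"
    have "g k (n div k) = real n ^ j * (1 / real k) * exp (- t) ^ n" if "k dvd n" for k
      using that \<open>n \<in> {1..M}\<close> unfolding g_def power_mult[symmetric] of_nat_mult[symmetric] by simp
    then show "real n ^ j * sigma_inv n * exp (- t) ^ n = (\<Sum>k | k dvd n. g k (n div k))"
      by (simp add: sigma_inv_def sum_distrib_left sum_distrib_right)
  qed
  also have "\<dots> \<le> (\<Sum>k=1..M. \<Sum>m=1..M. g k m)"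
    by (rule sum_divisors_le_sum_square) (simp add: g_def)
  also have "\<dots> \<le> (\<Sum>k=1..M. C / t ^ Suc j * (1 / real k ^ 2))"
  proof (rule sum_mono)
    fix k assume "k \<in> {1..M}"
    then have k: "real k > 0" by simp
    obtain i where i: "j = Suc i" using \<open>j > 0\<close> by (cases j) auto
    have "(\<Sum>m=1..M. g k m) = real k ^ i * (\<Sum>m=1..M. real m ^ j * exp (- (k * t)) ^ m)"
      using k by (simp add: g_def sum_distrib_left i power_mult_distrib field_simps
          exp_of_nat_mult[symmetric] del: exp_of_nat_mult)
    also have "\<dots> \<le> real k ^ i * (C / (k * t) ^ Suc j)"
      using k assms by (intro mult_left_mono assms(1)) auto
    also have "\<dots> = C / t ^ Suc j * (1 / real k ^ 2)"
      using k assms by (simp add: i field_simps power2_eq_square)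
    finally show "(\<Sum>m=1..M. g k m) \<le> C / t ^ Suc j * (1 / real k ^ 2)" .
  qed
  also have "\<dots> = C / t ^ Suc j * (\<Sum>k=1..M. 1 / real k ^ 2)"
    by (simp add: sum_distrib_left)
  also have "\<dots> \<le> C / t ^ Suc j * (33 / 20)"
    using assms by (intro mult_left_mono sum_inverse_squares_le) auto
  finally show ?thesis by simp
qed

section \<open>Power sums against exponentials, via hyperbolic functions\<close>

lemma sinh_ge:
  assumes "y \<ge> (0::real)"
  shows "sinh y \<ge> y + y ^ 3 / 6 + y ^ 5 / 120"
proof -
  define f where "f n = (if even n then 0 else y ^ n /\<^sub>R fact n)" for n :: nat
  have f: "f sums sinh y"
    using sinh_converges[of y] unfolding f_def .
  have "sum f {..<6} \<le> suminf f"
    using assms by (intro sum_le_suminf sums_summable[OF f]) (auto simp: f_def)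
  then have "sum f {..<6} \<le> sinh y"
    using sums_unique[OF f] by simp
  moreover have "sum f {..<6} = f 0 + f 1 + f 2 + f 3 + f 4 + f 5"
    by (simp add: eval_nat_numeral)
  moreover have "f 0 = 0" "f 1 = y" "f 2 = 0" "f 3 = y ^ 3 / 6" "f 4 = 0" "f 5 = y ^ 5 / 120"
    by (simp_all add: f_def fact_numeral)
  ultimately show ?thesis
    by linarith
qed

lemma sinh_square_ge:
  assumes "y \<ge> (0::real)"
  shows "sinh y ^ 2 \<ge> y ^ 2 + y ^ 4 / 3 + 2 * y ^ 6 / 45"
proof -
  have "(y + y ^ 3 / 6 + y ^ 5 / 120) ^ 2 = y ^ 2 + y ^ 4 / 3 + 2 * y ^ 6 / 45 + y ^ 8 / 360 + y ^ 10 / 14400"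
    by (simp add: power2_eq_square algebra_simps flip: power_add)
       (simp add: eval_nat_numeral algebra_simps)
  moreover have "(y + y ^ 3 / 6 + y ^ 5 / 120) ^ 2 \<le> sinh y ^ 2"
    using assms by (intro power_mono sinh_ge) auto
  ultimately show ?thesis
    using zero_le_power[OF assms, of 8] zero_le_power[OF assms, of 10] by linarith
qed

text \<open>Turns the closed forms of the sums of m^j exp(-s m), rational in exp(-s), into
  expressions in sinh y and cosh y with y = s/2.\<close>

lemma one_minus_exp_eq_sinh:
  "1 - exp (- s) = 2 * exp (- (s / 2)) * sinh (s / 2 :: real)"
  by (simp add: sinh_field_def field_simps flip: exp_add)

lemma sum_power1_exp_le:
  assumes "s > (0::real)"
  shows "(\<Sum>m=1..M. real m ^ 1 * exp (- s) ^ m) \<le> 1 / s ^ Suc 1"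
proof -
  define x where "x = exp (- s)"
  define y where "y = s / 2"
  have x: "0 < x" "x < 1" using assms by (auto simp: x_def)
  \<comment> \<open>Closed form of the partial sum together with its remainder, which is nonnegative
    and is dropped. The exponents 2 and 3 below are treated in the same way.\<close>
  have "(1 - x) ^ 2 * (\<Sum>m=1..M. real m ^ 1 * x ^ m) + x ^ Suc M * (M * (1 - x) + 1) = x"
    by (induction M) (auto simp: algebra_simps power2_eq_square)
  moreover have "x ^ Suc M * (M * (1 - x) + 1) \<ge> 0" using x by simp
  ultimately have "(1 - x) ^ 2 * (\<Sum>m=1..M. real m ^ 1 * x ^ m) \<le> x" by linarith
  then have "(\<Sum>m=1..M. real m ^ 1 * x ^ m) \<le> x / (1 - x) ^ 2"
    using x by (simp add: pos_le_divide_eq mult.commute)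
  also have "x = exp (- y) ^ 2"
    by (simp add: x_def y_def flip: exp_of_nat_mult)
  then have "x / (1 - x) ^ 2 = 1 / (4 * sinh y ^ 2)"
    using one_minus_exp_eq_sinh[of s] by (simp add: x_def y_def power_mult_distrib)
  also have "\<dots> \<le> 1 / (4 * y ^ 2)"
  proof (intro divide_left_mono mult_left_mono power_mono)
    have "0 \<le> y ^ 3 / 6" "0 \<le> y ^ 5 / 120" using assms by (auto simp: y_def)
    moreover have "0 \<le> y" using assms by (simp add: y_def)
    ultimately show "y \<le> sinh y" using sinh_ge[of y] by linarith
  qed (use assms in \<open>auto simp: y_def\<close>)
  finally show ?thesis by (simp add: x_def y_def power2_eq_square)
qed

text \<open>The infinite series equals cosh y / (4 sinh^3 y) with y = s/2, so the claim is y^3 cosh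
  y \<le> sinh^3 y. Squared, with v = y^2 and w = sinh^2 y, it is the polynomial inequality v^3 (1 +
  w) \<le> w^3.\<close>

lemma sum_power2_exp_le:
  assumes "s > (0::real)"
  shows "(\<Sum>m=1..M. real m ^ 2 * exp (- s) ^ m) \<le> 2 / s ^ Suc 2"
proof -
  define x where "x = exp (- s)"
  define y where "y = s / 2"
  define e where "e = exp (- y)"
  have x: "0 < x" "x < 1" using assms by (auto simp: x_def)
  have y: "y > 0" using assms by (simp add: y_def)
  have xe: "x = e ^ 2"
    by (simp add: x_def y_def e_def flip: exp_of_nat_mult)
  have e: "e > 0" by (simp add: e_def)
  have ch: "1 + x = 2 * e * cosh y"
    by (simp add: x_def y_def e_def cosh_field_def field_simps flip: exp_add)
  have sh: "1 - x = 2 * e * sinh y"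
    using one_minus_exp_eq_sinh[of s] by (simp add: x_def y_def e_def)
  have "(1 - x) ^ 3 * (\<Sum>m=1..M. real m ^ 2 * x ^ m)
      + x ^ Suc M * (M ^ 2 * (1 - x) ^ 2 + 2 * M * (1 - x) + (1 + x)) = x * (1 + x)"
    by (induction M) (auto simp: algebra_simps power2_eq_square power3_eq_cube)
  moreover have "x ^ Suc M * (M ^ 2 * (1 - x) ^ 2 + 2 * M * (1 - x) + (1 + x)) \<ge> 0"
    using x by simp
  ultimately have "(1 - x) ^ 3 * (\<Sum>m=1..M. real m ^ 2 * x ^ m) \<le> x * (1 + x)" by linarith
  then have "(\<Sum>m=1..M. real m ^ 2 * x ^ m) \<le> x * (1 + x) / (1 - x) ^ 3"
    using x by (simp add: pos_le_divide_eq mult.commute)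
  also have "x * (1 + x) / (1 - x) ^ 3 = cosh y / (4 * sinh y ^ 3)"
    unfolding sh ch using e by (simp add: xe power_mult_distrib field_simps eval_nat_numeral)
  also have "\<dots> \<le> 1 / (4 * y ^ 3)"
  proof -
    define v w where "v = y ^ 2" and "w = sinh y ^ 2"
    have v: "v > 0" using y by (simp add: v_def)
    have "y ^ 4 = v ^ 2" "y ^ 6 = v ^ 3" by (simp_all add: v_def flip: power_mult)
    then have "w \<ge> v + v ^ 2 / 3 + 2 * v ^ 3 / 45"
      using sinh_square_ge[of y] y unfolding w_def v_def by simp
    moreover have "2 * v ^ 3 / 45 \<ge> 0" using v by simp
    ultimately have w: "w \<ge> v + v ^ 2 / 3" by linarith
    \<comment> \<open>The goal is v^3 \<le> w (w^2 - v^3), whose right side increases for w \<ge> v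
      + v^2/3. At that lower bound of w it exceeds v^3 by v^6/27.\<close>
    have "v ^ 3 \<le> v ^ 3 * (1 + v / 3) ^ 3 - v ^ 3 * (v + v ^ 2 / 3)"
    proof -
      have "v ^ 3 * (1 + v / 3) ^ 3 - v ^ 3 * (v + v ^ 2 / 3) = v ^ 3 + v ^ 6 / 27"
        by (simp add: eval_nat_numeral field_simps)
      then show ?thesis using v by simp
    qed
    also have "\<dots> = (v + v ^ 2 / 3) * ((v + v ^ 2 / 3) ^ 2 - v ^ 3)"
      by (simp add: eval_nat_numeral field_simps)
    also have "\<dots> \<le> w * (w ^ 2 - v ^ 3)"
    proof (intro mult_mono diff_right_mono power_mono w)
      have "(v + v ^ 2 / 3) ^ 2 - v ^ 3 = v ^ 2 * ((1 - v / 6) ^ 2 + v ^ 2 / 12)"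
        by (simp add: eval_nat_numeral algebra_simps)
      then show "0 \<le> (v + v ^ 2 / 3) ^ 2 - v ^ 3" by simp
    qed (use v w in \<open>auto simp: w_def\<close>)
    finally have "v ^ 3 * (1 + w) \<le> w ^ 3"
      by (simp add: algebra_simps eval_nat_numeral)
    then have "(y ^ 3 * cosh y) ^ 2 \<le> (sinh y ^ 3) ^ 2"
      by (simp add: v_def w_def cosh_square_eq power_mult_distrib flip: power_mult)
         (simp add: algebra_simps)
    then have "y ^ 3 * cosh y \<le> sinh y ^ 3"
      by (rule power2_le_imp_le) (use y in simp)
    then show ?thesis using y by (simp add: divide_simps mult.commute)
  qed
  finally show ?thesis by (simp add: x_def y_def eval_nat_numeral)
qed

text \<open>The constant 3! = 6 would be too small, because the infinite series behaves like 6/s^4 +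
  1/120 as s tends to 0; hence 7. With y = s/2, v = y^2 and w = sinh^2 y the series equals (2 w +
  3)/(8 w^2), and the claim becomes 7 w^2 - 4 v^2 w - 6 v^2 \<ge> 0.\<close>

lemma sum_power3_exp_le:
  assumes "s > (0::real)"
  shows "(\<Sum>m=1..M. real m ^ 3 * exp (- s) ^ m) \<le> 7 / s ^ Suc 3"
proof -
  define x where "x = exp (- s)"
  define y where "y = s / 2"
  define e where "e = exp (- y)"
  define v w where "v = y ^ 2" and "w = sinh y ^ 2"
  have x: "0 < x" "x < 1" using assms by (auto simp: x_def)
  have y: "y > 0" using assms by (simp add: y_def)
  have xe: "x = e ^ 2"
    by (simp add: x_def y_def e_def flip: exp_of_nat_mult)
  have e: "e > 0" by (simp add: e_def)
  have v: "v > 0" using y by (simp add: v_def)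
  have w0: "w > 0" using y by (simp add: w_def)
  have sh: "1 - x = 2 * e * sinh y"
    using one_minus_exp_eq_sinh[of s] by (simp add: x_def y_def e_def)
  have ch: "1 + 4 * x + x ^ 2 = 2 * x * (2 * w + 3)"
  proof -
    have "1 + 4 * x + x ^ 2 = (1 - x) ^ 2 + 6 * x" by (simp add: power2_eq_square algebra_simps)
    also have "\<dots> = 2 * x * (2 * w + 3)"
      unfolding sh by (simp add: w_def xe power_mult_distrib algebra_simps)
    finally show ?thesis .
  qed
  have "(1 - x) ^ 4 * (\<Sum>m=1..M. real m ^ 3 * x ^ m)
      + x ^ Suc M * (M ^ 3 * (1 - x) ^ 3 + 3 * M ^ 2 * (1 - x) ^ 2 + 3 * M * (1 - x) * (1 + x)
        + (1 + 4 * x + x ^ 2)) = x * (1 + 4 * x + x ^ 2)"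
    by (induction M) (auto simp: algebra_simps power2_eq_square power3_eq_cube power4_eq_xxxx)
  moreover have "x ^ Suc M * (M ^ 3 * (1 - x) ^ 3 + 3 * M ^ 2 * (1 - x) ^ 2 + 3 * M * (1 - x) * (1 + x)
        + (1 + 4 * x + x ^ 2)) \<ge> 0"
    using x by simp
  ultimately have "(1 - x) ^ 4 * (\<Sum>m=1..M. real m ^ 3 * x ^ m) \<le> x * (1 + 4 * x + x ^ 2)" by linarith
  then have "(\<Sum>m=1..M. real m ^ 3 * x ^ m) \<le> x * (1 + 4 * x + x ^ 2) / (1 - x) ^ 4"
    using x by (simp add: pos_le_divide_eq mult.commute)
  also have "(1 - x) ^ 4 = 16 * x ^ 2 * w ^ 2"
    unfolding sh by (simp add: xe w_def power_mult_distrib flip: power_mult)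
  also have "x * (1 + 4 * x + x ^ 2) / (16 * x ^ 2 * w ^ 2) = (2 * w + 3) / (8 * w ^ 2)"
    unfolding ch using x w0 by (simp add: field_simps eval_nat_numeral)
  also have "\<dots> \<le> 7 / (16 * v ^ 2)"
  proof -
    define u where "u = v + v ^ 2 / 3 + 2 * v ^ 3 / 45"
    have "y ^ 4 = v ^ 2" "y ^ 6 = v ^ 3" by (simp_all add: v_def flip: power_mult)
    then have w: "w \<ge> u"
      using sinh_square_ge[of y] y unfolding w_def v_def u_def by simp
    \<comment> \<open>At the Taylor lower bound u of w every coefficient in v is positive. Passing
      from u to w only increases the expression, since v^2 \<le> 3 u gives 4 v^2 \<le> 12 u \<le> 7
      (w + u).\<close>
    have "0 \<le> 7 * u ^ 2 - 4 * v ^ 2 * u - 6 * v ^ 2"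
    proof -
      have "7 * u ^ 2 - 4 * v ^ 2 * u - 6 * v ^ 2 =
        v ^ 2 + 2 * v ^ 3 / 3 + v ^ 4 / 15 + (4 * 7 / 135 - 8 / 45) * v ^ 5 + 28 / 2025 * v ^ 6"
        unfolding u_def by (simp add: eval_nat_numeral algebra_simps)
      then show ?thesis using v by simp
    qed
    also have "\<dots> \<le> 7 * w ^ 2 - 4 * v ^ 2 * w - 6 * v ^ 2"
    proof -
      have "v ^ 2 / 3 \<le> u" using v by (simp add: u_def)
      then have *: "v ^ 2 \<le> 3 * u" by simp
      have "u \<ge> 0" using v by (simp add: u_def)
      then have "4 * v ^ 2 \<le> 7 * (w + u)" using * w by argo
      then have "0 \<le> (w - u) * (7 * (w + u) - 4 * v ^ 2)"
        using w by simp
      then show ?thesis by (simp add: algebra_simps power2_eq_square)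
    qed
    finally show ?thesis using v w0 by (simp add: divide_simps algebra_simps)
  qed
  finally show ?thesis by (simp add: x_def y_def v_def eval_nat_numeral)
qed

section \<open>The logarithm of the generating function\<close>

lemma summable_sigma_inv_moment:
  fixes \<rho> :: real
  assumes "0 \<le> \<rho>" "\<rho> < 1" "j \<le> 3"
  shows "summable (\<lambda>n. real n ^ j * sigma_inv n * \<rho> ^ n)"
proof (rule summable_comparison_test')
  \<comment> \<open>The maximum with 1/2 keeps the logarithm meaningful at \<rho> = 0. The third
    moment at this larger base dominates the lower ones from index 1 on.\<close>
  define t where "t = - ln (max \<rho> (1 / 2))"
  have t: "t > 0" "exp (- t) = max \<rho> (1 / 2)"
    using assms by (auto simp: t_def)
  show "summable (\<lambda>n. real n ^ 3 * sigma_inv n * exp (- t) ^ n)"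
  proof (rule summableI_nonneg_bounded)
    show "(\<Sum>n<M. real n ^ 3 * sigma_inv n * exp (- t) ^ n) \<le> 33 / 20 * 7 / t ^ Suc 3" for M
      using t by (intro sum_power_sigma_inv_exp_le sum_power3_exp_le) auto
  qed (simp add: sigma_inv_nonneg)
  fix n :: nat assume "n \<ge> 1"
  have "real n ^ j * sigma_inv n * \<rho> ^ n \<le> real n ^ 3 * sigma_inv n * exp (- t) ^ n"
    using assms \<open>n \<ge> 1\<close> t
    by (intro mult_mono power_increasing power_mono) (auto simp: sigma_inv_nonneg)
  then show "norm (real n ^ j * sigma_inv n * \<rho> ^ n) \<le> real n ^ 3 * sigma_inv n * exp (- t) ^ n"
    using assms by (simp add: sigma_inv_nonneg)
qed

text \<open>Both sides regroup the double series of q^(m k)/k over m, k \<ge> 1: fixing m gives -Ln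
  (1 - q^m), fixing n = m k gives \<open>sigma_inv n * q ^ n\<close>. The zeroth moment at
  \<open>norm q\<close> supplies the absolute convergence that permits this.\<close>

lemma sums_sigma_inv_Ln:
  fixes q :: complex
  assumes "norm q < 1"
  shows "(\<lambda>n. of_real (sigma_inv n) * q ^ n) sums (- (\<Sum>m. Ln (1 - q ^ Suc m)))"
proof -
  define g :: "nat \<times> nat \<Rightarrow> complex" where "g = (\<lambda>(n, k). q ^ n / of_nat k)"
  define f :: "nat \<times> nat \<Rightarrow> complex" where "f = (\<lambda>(m, k). q ^ (m * k) / of_nat k)"
  have norm_inner: "(\<Sum>k | k dvd n. norm (g (n, k))) = sigma_inv n * norm q ^ n" for n
    by (simp add: g_def norm_divide norm_power sigma_inv_def sum_distrib_right)
  have "(\<lambda>n. sigma_inv n * norm q ^ n) summable_on UNIV"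
    using summable_sigma_inv_moment[of "norm q" 0] assms
    by (intro summable_nonneg_imp_summable_on) (auto simp: sigma_inv_nonneg)
  then have "(\<lambda>n. sigma_inv n * norm q ^ n) summable_on {1..}"
    by (rule summable_on_subset_banach) simp
  then have "(\<lambda>p. norm (g p)) summable_on (SIGMA n:{1..}. {k. k dvd n})"
  proof (subst Infinite_Sum.abs_summable_on_Sigma_iff, intro conjI ballI)
    fix n :: nat assume "n \<in> {1..}"
    then show "(\<lambda>k. norm (g (n, k))) summable_on {k. k dvd n}"
      by (intro summable_on_finite) simp
  next
    have "norm (\<Sum>\<^sub>\<infinity>k\<in>{k. k dvd n}. norm (g (n, k))) = sigma_inv n * norm q ^ n"
      if "n \<in> {1..}" for n
      using that by (subst infsum_finite) (simp_all add: norm_inner sigma_inv_nonneg)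
    then show "(\<lambda>n. norm (\<Sum>\<^sub>\<infinity>k\<in>{k. k dvd n}. norm (g (n, k)))) summable_on {1..}"
      using \<open>(\<lambda>n. sigma_inv n * norm q ^ n) summable_on {1..}\<close>
      by (rule summable_on_cong[THEN iffD2])
  qed
  then obtain s where s: "(g has_sum s) (SIGMA n:{1..}. {k. k dvd n})"
    using Infinite_Sum.abs_summable_summable summable_on_def by metis
  have "((\<lambda>n. of_real (sigma_inv n) * q ^ n) has_sum s) {1..}"
  proof (rule has_sum_SigmaD[OF s])
    fix n :: nat assume "n \<in> {1..}"
    then have "finite {k. k dvd n}" by simp
    then show "((\<lambda>k. g (n, k)) has_sum of_real (sigma_inv n) * q ^ n) {k. k dvd n}"
      by (intro has_sum_finiteI) (simp_all add: g_def sigma_inv_def sum_distrib_right)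
  qed
  then have "((\<lambda>n. of_real (sigma_inv n) * q ^ n) has_sum s) UNIV"
    by (subst has_sum_cong_neutral[where T = "{1..}"]) (auto simp: not_le)
  then have 1: "(\<lambda>n. of_real (sigma_inv n) * q ^ n) sums s"
    by (rule has_sum_imp_sums)
  \<comment> \<open>Change of indices n = m k, from pairs (n, k) with k dividing n to all pairs (m,
    k).\<close>
  have "(g has_sum s) (SIGMA n:{1..}. {k. k dvd n}) \<longleftrightarrow> (f has_sum s) ({1..} \<times> {1..})"
    by (rule has_sum_reindex_bij_witness[where i = "\<lambda>(m, k). (m * k, k)" and j = "\<lambda>(n, k). (n div k, k)"])
       (auto simp: f_def g_def Suc_le_eq div_greater_zero_iff dvd_imp_le intro: Nat.gr0I)
  with s have "(f has_sum s) ({1..} \<times> {1..})" by simp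
  then have "((\<lambda>m. - Ln (1 - q ^ m)) has_sum s) {1..}"
  proof (rule has_sum_SigmaD)
    fix m :: nat assume "m \<in> {1..}"
    then obtain i where i: "m = Suc i" by (cases m) auto
    have q: "norm (q ^ m) < 1"
      using power_decreasing[of 1 "Suc i" "norm q"] assms by (simp add: i norm_power del: power_Suc)
    have "(\<lambda>k. - (- ((q ^ m) ^ k) / of_nat k)) sums (- Ln (1 - q ^ m))"
      using Ln_series'[of "- (q ^ m)"] q by (intro sums_minus) simp
    then have "(\<lambda>k. f (m, k)) sums (- Ln (1 - q ^ m))"
      by (simp add: f_def power_mult)
    moreover have "summable (\<lambda>k. norm (f (m, k)))"
    proof (rule summable_comparison_test')
      show "summable (\<lambda>k. norm (q ^ m) ^ k)"
        using q by (intro summable_geometric) simp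
      fix k :: nat assume "k \<ge> 1"
      have "norm (f (m, k)) = norm (q ^ m) ^ k / real k"
        by (simp add: f_def norm_divide norm_power power_mult)
      also have "\<dots> \<le> norm (q ^ m) ^ k / 1"
        using \<open>k \<ge> 1\<close> by (intro divide_left_mono) auto
      finally show "norm (norm (f (m, k))) \<le> norm (q ^ m) ^ k" by simp
    qed
    ultimately have "((\<lambda>k. f (m, k)) has_sum (- Ln (1 - q ^ m))) UNIV"
      by (intro norm_summable_imp_has_sum)
    then show "((\<lambda>k. f (m, k)) has_sum (- Ln (1 - q ^ m))) {1..}"
      by (subst has_sum_cong_neutral[where T = UNIV]) (auto simp: f_def not_le)
  qed
  also have "{1..} = range Suc"
    by (auto simp: image_iff Suc_le_eq gr0_conv_Suc)
  finally have "((\<lambda>m. - Ln (1 - q ^ Suc m)) has_sum s) UNIV"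
    by (subst (asm) has_sum_reindex) (simp_all add: o_def del: power_Suc)
  then have "(\<lambda>m. - Ln (1 - q ^ Suc m)) sums s"
    by (rule has_sum_imp_sums)
  moreover have "(\<lambda>m. - Ln (1 - q ^ Suc m)) sums (- (\<Sum>m. Ln (1 - q ^ Suc m)))"
    by (intro sums_minus summable_sums summable_Ln_one_minus_power assms)
  ultimately show ?thesis
    using 1 sums_unique2 by blast
qed

lemma frac_partition_sums_gf:
  assumes "norm (q::complex) < 1"
  shows "(\<lambda>n. of_real (frac_partition \<alpha> n) * q ^ n) sums frac_partition_gf \<alpha> q"
  using frac_partition_sums[OF assms, of \<alpha>] by (simp only: frac_partition_gf_def)

lemma frac_partition_gf_eq_exp_sigma_inv:
  assumes "norm (q::complex) < 1"
  shows "frac_partition_gf \<alpha> q = exp (of_real \<alpha> * (\<Sum>n. of_real (sigma_inv n) * q ^ n))"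
  using frac_partition_gf_eq_exp[OF assms, of \<alpha>] sums_sigma_inv_Ln[OF assms]
  by (simp add: sums_iff del: power_Suc)

section \<open>Recurrence and positivity of the coefficients\<close>

lemma has_fps_expansion_of_sums:
  fixes c :: "nat \<Rightarrow> complex"
  assumes "\<And>q. norm q < 1 \<Longrightarrow> (\<lambda>n. c n * q ^ n) sums f q"
  shows "f has_fps_expansion Abs_fps c"
  unfolding has_fps_expansion_def
proof
  have "conv_radius c \<ge> norm (1/2 :: complex)"
    by (rule conv_radius_geI) (use assms[of "1/2"] in \<open>auto simp: sums_iff\<close>)
  then show "fps_conv_radius (Abs_fps c) > 0"
    unfolding fps_conv_radius_def by (auto intro: less_le_trans[rotated])
  have "eventually (\<lambda>z. z \<in> ball (0::complex) 1) (nhds 0)"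
    by (intro eventually_nhds_in_open) auto
  then show "eventually (\<lambda>z. eval_fps (Abs_fps c) z = f z) (nhds 0)"
    by eventually_elim (use assms in \<open>auto simp: eval_fps_def sums_iff\<close>)
qed

text \<open>Comparison of coefficients in F' = \<alpha> L' F, where F = exp(\<alpha> L) and L has
  the coefficients \<open>sigma_inv\<close>. For \<alpha> > 0 the recurrence has positive weights,
  which gives \<open>frac_partition_pos\<close>.\<close>

lemma frac_partition_Suc:
  "real (Suc n) * frac_partition \<alpha> (Suc n) =
     \<alpha> * (\<Sum>i\<le>n. real (Suc i) * sigma_inv (Suc i) * frac_partition \<alpha> (n - i))"
proof -
  define L where "L q = - (\<Sum>m. Ln (1 - q ^ Suc m))" for q :: complex
  define G where "G = Abs_fps (\<lambda>n. complex_of_real (frac_partition \<alpha> n))"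
  define S where "S = Abs_fps (\<lambda>n. complex_of_real (sigma_inv n))"
  have G: "frac_partition_gf \<alpha> has_fps_expansion G"
    unfolding G_def by (intro has_fps_expansion_of_sums frac_partition_sums_gf)
  have S: "L has_fps_expansion S"
    unfolding S_def L_def by (intro has_fps_expansion_of_sums sums_sigma_inv_Ln)
  have holL: "L holomorphic_on ball 0 1"
    unfolding L_def by (intro holomorphic_intros holomorphic_suminf_Ln_one_minus_power)
  have gf: "exp (of_real \<alpha> * L q) = frac_partition_gf \<alpha> q" if "q \<in> ball 0 1" for q
    using that by (simp add: frac_partition_gf_eq_exp L_def)
  have deriv: "deriv (frac_partition_gf \<alpha>) q = of_real \<alpha> * deriv L q * frac_partition_gf \<alpha> q"
    if "q \<in> ball 0 1" for q
  proof (rule DERIV_imp_deriv)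
    have "(L has_field_derivative deriv L q) (at q)"
      using holL that by (intro holomorphic_derivI) auto
    then have "((\<lambda>q. exp (of_real \<alpha> * L q)) has_field_derivative
        of_real \<alpha> * deriv L q * exp (of_real \<alpha> * L q)) (at q)"
      by (auto intro!: derivative_eq_intros)
    then show "(frac_partition_gf \<alpha> has_field_derivative
        of_real \<alpha> * deriv L q * frac_partition_gf \<alpha> q) (at q)"
      using that gf by (auto intro: has_field_derivative_transform_within_open[where S = "ball 0 1"])
  qed
  have "deriv (frac_partition_gf \<alpha>) has_fps_expansion fps_deriv G"
    by (intro has_fps_expansion_deriv G)
  moreover have "(\<lambda>q. of_real \<alpha> * deriv L q * frac_partition_gf \<alpha> q) has_fps_expansion
      (fps_const (of_real \<alpha>) * fps_deriv S * G)"
    by (intro fps_expansion_intros has_fps_expansion_deriv G S)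
  then have "deriv (frac_partition_gf \<alpha>) has_fps_expansion (fps_const (of_real \<alpha>) * fps_deriv S * G)"
  proof (rule has_fps_expansion_cong[THEN iffD2, rotated 2])
    have "eventually (\<lambda>z. z \<in> ball (0::complex) 1) (nhds 0)"
      by (intro eventually_nhds_in_open) auto
    then show "eventually (\<lambda>q. deriv (frac_partition_gf \<alpha>) q =
        of_real \<alpha> * deriv L q * frac_partition_gf \<alpha> q) (nhds 0)"
      by eventually_elim (rule deriv)
  qed simp
  ultimately have "fps_deriv G = fps_const (of_real \<alpha>) * fps_deriv S * G"
    by (rule fps_expansion_unique_complex)
  then have "fps_nth (fps_deriv G) n = fps_nth (fps_const (of_real \<alpha>) * (fps_deriv S * G)) n"
    by (simp only: mult.assoc)
  then have "fps_nth (fps_deriv G) n = of_real \<alpha> * fps_nth (fps_deriv S * G) n"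
    by (simp only: fps_mult_left_const_nth)
  then have "complex_of_real (real (Suc n) * frac_partition \<alpha> (Suc n)) =
     of_real (\<alpha> * (\<Sum>i\<le>n. real (Suc i) * sigma_inv (Suc i) * frac_partition \<alpha> (n - i)))"
    by (simp only: fps_mult_nth fps_deriv_nth G_def S_def fps_nth_Abs_fps
        atLeast0AtMost Suc_eq_plus1[symmetric] of_real_mult of_real_sum of_real_of_nat_eq)
  then show ?thesis
    by (simp only: of_real_eq_iff)
qed

lemma frac_partition_0 [simp]: "frac_partition \<alpha> 0 = 1"
proof -
  have "complex_of_real (frac_partition \<alpha> 0) = frac_partition_gf \<alpha> 0"
    using frac_partition_sums_gf[of 0 \<alpha>] by (simp add: sums_iff)
  also have "\<dots> = 1"
    by (simp add: frac_partition_gf_eq_exp)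
  finally show ?thesis by simp
qed

lemma frac_partition_pos:
  assumes "\<alpha> > 0"
  shows "frac_partition \<alpha> n > 0"
proof (induction n rule: less_induct)
  case (less n)
  show ?case
  proof (cases n)
    case (Suc k)
    have "0 < \<alpha> * (\<Sum>i\<le>k. real (Suc i) * sigma_inv (Suc i) * frac_partition \<alpha> (k - i))"
    proof (intro mult_pos_pos assms sum_pos)
      show "0 < sigma_inv (Suc i)" for i
        using sigma_inv_ge_1[of "Suc i"] by simp
    qed (use Suc less.IH in auto)
    then have "0 < real (Suc k) * frac_partition \<alpha> (Suc k)"
      by (simp only: frac_partition_Suc)
    then show ?thesis
      unfolding Suc by (rule zero_less_mult_pos) simp
  qed simp
qed

section \<open>Log-concavity from a nonnegative integral\<close>

lemma has_integral_cos_int: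
  "((\<lambda>u. cos (of_int j * u)) has_integral (if j = 0 then pi else 0)) {0..pi}"
proof (cases "j = 0")
  case True
  then show ?thesis using has_integral_const_real[of "1::real" 0 pi] by simp
next
  case False
  have "((\<lambda>u. cos (of_int j * u)) has_integral
      (sin (of_int j * pi) / of_int j - sin (of_int j * 0) / of_int j)) {0..pi}"
    using False
    by (intro fundamental_theorem_of_calculus)
       (auto intro!: derivative_eq_intros simp flip: has_real_derivative_iff_has_vector_derivative)
  then show ?thesis using False by (simp add: sin_npi_int mult.commute)
qed

lemma has_integral_cos_times_one_minus_cos:
  "((\<lambda>u. cos (of_int j * u) * (1 - cos u)) has_integral
     (if j = 0 then pi else if \<bar>j\<bar> = 1 then - (pi / 2) else 0)) {0..pi}"
proof -
  have eq: "cos (of_int j * u) * (1 - cos u)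
      = cos (of_int j * u) - (cos (of_int (j + 1) * u) + cos (of_int (j - 1) * u)) / 2" for u :: real
    by (simp add: algebra_simps cos_add cos_diff)
  have "((\<lambda>u. cos (of_int j * u) - (cos (of_int (j + 1) * u) + cos (of_int (j - 1) * u)) / 2) has_integral
     (if j = 0 then pi else 0) - ((if j + 1 = 0 then pi else 0) + (if j - 1 = 0 then pi else 0)) / 2) {0..pi}"
    by (intro has_integral_diff has_integral_divide has_integral_add has_integral_cos_int)
  moreover have "(if j = 0 then pi else 0) - ((if j + 1 = 0 then pi else 0) + (if j - 1 = 0 then pi else 0)) / 2
      = (if j = 0 then pi else if \<bar>j\<bar> = 1 then - (pi / 2) else 0)"
    by auto
  ultimately show ?thesis unfolding eq by simp
qed

text \<open>The kernel 1 - cos u contains only the frequencies 0 and 1, so after the shift by n only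
  the terms k = n - 1, n, n + 1 survive; the result is -pi/2 times the second difference of w at n.
  Uniform convergence with majorant 2 |w k| justifies termwise integration.\<close>

lemma powser_cis_integral:
  fixes w :: "nat \<Rightarrow> real" and n :: nat
  assumes w: "summable (\<lambda>k. \<bar>w k\<bar>)" and "n > 0"
    and g: "\<And>u. (\<lambda>k. w k * cos ((real k - real n) * u)) sums g u"
  shows "((\<lambda>u. g u * (1 - cos u)) has_integral (pi * w n - pi / 2 * (w (n - 1) + w (n + 1)))) {0..pi}"
proof -
  define h where "h k u = w k * cos ((real k - real n) * u) * (1 - cos u)" for k u
  define c where "c k = (if k = n then pi * w n else if k + 1 = n \<or> k = n + 1 then - (pi / 2) * w k else 0)" for k
  have h: "(h k has_integral c k) {0..pi}" for k
  proof -
    have "((\<lambda>u. w k * (cos (of_int (int k - int n) * u) * (1 - cos u))) has_integral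
      w k * (if int k - int n = 0 then pi else if \<bar>int k - int n\<bar> = 1 then - (pi / 2) else 0)) {0..pi}"
      by (intro has_integral_mult_right has_integral_cos_times_one_minus_cos)
    moreover have "w k * (if int k - int n = 0 then pi else if \<bar>int k - int n\<bar> = 1 then - (pi / 2) else 0) = c k"
      by (auto simp: c_def)
    ultimately show ?thesis unfolding h_def by (simp add: mult.assoc)
  qed
  have lim: "uniform_limit {0..pi} (\<lambda>N u. \<Sum>k<N. h k u) (\<lambda>u. \<Sum>k. h k u) sequentially"
  proof (rule Weierstrass_m_test)
    show "summable (\<lambda>k. \<bar>w k\<bar> * 2)" by (intro summable_mult2 w)
    fix k u
    have "\<bar>w k\<bar> * \<bar>cos ((real k - real n) * u)\<bar> * \<bar>1 - cos u\<bar> \<le> \<bar>w k\<bar> * 1 * 2"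
      by (intro mult_mono) (use cos_le_one[of u] cos_ge_minus_one[of u] in \<open>auto simp: abs_le_iff\<close>)
    then show "norm (h k u) \<le> \<bar>w k\<bar> * 2"
      by (simp add: h_def abs_mult)
  qed
  have suminf: "(\<Sum>k. h k u) = g u * (1 - cos u)" for u
    using sums_mult2[OF g[of u], of "1 - cos u"] by (simp add: h_def sums_iff)
  have int: "((\<lambda>u. \<Sum>k<N. h k u) has_integral (\<Sum>k<N. c k)) {0..pi}" for N
    by (intro has_integral_sum h) simp
  have cont: "continuous_on {0..pi} (\<lambda>u. \<Sum>k<N. h k u)" for N
    unfolding h_def by (intro continuous_intros)
  obtain I J where I: "\<And>N. ((\<lambda>u. \<Sum>k<N. h k u) has_integral I N) {0..pi}"
    and J: "((\<lambda>u. g u * (1 - cos u)) has_integral J) {0..pi}" and IJ: "I \<longlonglongrightarrow> J"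
    using uniform_limit_integral[OF lim cont sequentially_bot] unfolding suminf by blast
  have "I N = (\<Sum>k<N. c k)" for N
    using has_integral_unique[OF I int] .
  \<comment> \<open>Once N exceeds n + 1 all three surviving terms are present, so the partial
    integrals no longer change.\<close>
  moreover have "(\<Sum>k<N. c k) = pi * w n - pi / 2 * (w (n - 1) + w (n + 1))" if "N > n + 1" for N
  proof -
    have "(\<Sum>k<N. c k) = (\<Sum>k\<in>{n - 1, n, n + 1}. c k)"
      using that \<open>n > 0\<close> by (intro sum.mono_neutral_right) (auto simp: c_def)
    also have "\<dots> = pi * w n - pi / 2 * (w (n - 1) + w (n + 1))"
    proof -
      obtain m where "n = Suc m" using \<open>n > 0\<close> by (cases n) auto
      then show ?thesis by (simp add: c_def algebra_simps)
    qed
    finally show ?thesis .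
  qed
  ultimately have "eventually (\<lambda>N. I N = pi * w n - pi / 2 * (w (n - 1) + w (n + 1))) sequentially"
    by (intro eventually_sequentiallyI[of "n + 2"]) simp
  then have "I \<longlonglongrightarrow> pi * w n - pi / 2 * (w (n - 1) + w (n + 1))"
    by (rule tendsto_eventually)
  with IJ J show ?thesis
    using LIMSEQ_unique by blast
qed

text \<open>The additive inequality for w k = p(k) r^k becomes multiplicative through 4 a b \<le> (a
  + b)^2. Both sides then carry the factor r^(2 n), so any r in (0, 1) may serve.\<close>

lemma log_concave_of_integral_nonneg:
  fixes \<alpha> r :: real and n :: nat
  assumes "\<alpha> > 0" "0 < r" "r < 1" "n > 0"
    and "integral {0..pi} (\<lambda>u. Re (frac_partition_gf \<alpha> (of_real r * cis u) * cis (- (real n * u))) * (1 - cos u)) \<ge> 0"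
  shows "frac_partition \<alpha> (n - 1) * frac_partition \<alpha> (n + 1) \<le> frac_partition \<alpha> n ^ 2"
proof -
  define w where "w k = frac_partition \<alpha> k * r ^ k" for k
  have w_pos: "w k > 0" for k
    using assms by (simp add: w_def frac_partition_pos)
  have "(\<lambda>k. of_real (frac_partition \<alpha> k) * complex_of_real r ^ k) sums frac_partition_gf \<alpha> (of_real r)"
    using assms by (intro frac_partition_sums_gf) simp
  then have "summable (\<lambda>k. complex_of_real (w k))"
    by (simp add: w_def sums_iff)
  then have summ: "summable (\<lambda>k. \<bar>w k\<bar>)"
    using w_pos by (simp add: summable_of_real_iff less_imp_le)
  have "(\<lambda>k. w k * cos ((real k - real n) * u)) sums
      Re (frac_partition_gf \<alpha> (of_real r * cis u) * cis (- (real n * u)))" for u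
  proof -
    have "(\<lambda>k. of_real (frac_partition \<alpha> k) * (of_real r * cis u) ^ k * cis (- (real n * u))) sums
        (frac_partition_gf \<alpha> (of_real r * cis u) * cis (- (real n * u)))"
      using assms by (intro sums_mult2 frac_partition_sums_gf) (simp add: norm_mult)
    moreover have "of_real (frac_partition \<alpha> k) * (of_real r * cis u) ^ k * cis (- (real n * u))
        = of_real (w k) * cis ((real k - real n) * u)" for k
    proof -
      have "cis u ^ k * cis (- (real n * u)) = cis ((real k - real n) * u)"
        by (subst Complex.DeMoivre, subst cis_mult, rule arg_cong[of _ _ cis]) (simp add: algebra_simps)
      then show ?thesis by (simp add: w_def power_mult_distrib mult.assoc)
    qed
    ultimately have "(\<lambda>k. of_real (w k) * cis ((real k - real n) * u)) sums
        (frac_partition_gf \<alpha> (of_real r * cis u) * cis (- (real n * u)))"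
      by simp
    then show ?thesis
      by (auto dest!: sums_Re)
  qed
  from powser_cis_integral[OF summ \<open>n > 0\<close> this] assms(5)
  have "0 \<le> pi * w n - pi / 2 * (w (n - 1) + w (n + 1))"
    by (simp add: integral_unique)
  also have "\<dots> = pi / 2 * (2 * w n - (w (n - 1) + w (n + 1)))"
    by (simp add: algebra_simps)
  finally have le: "w (n - 1) + w (n + 1) \<le> 2 * w n"
    using pi_gt_zero by (simp add: zero_le_mult_iff)
  have "4 * (w (n - 1) * w (n + 1)) \<le> (w (n - 1) + w (n + 1)) ^ 2"
    using zero_le_power2[of "w (n - 1) - w (n + 1)"] by (simp add: power2_eq_square algebra_simps)
  also have "\<dots> \<le> (2 * w n) ^ 2"
    using le w_pos[of "n - 1"] w_pos[of "n + 1"] by (intro power_mono) auto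
  finally have "w (n - 1) * w (n + 1) \<le> w n ^ 2"
    by (simp add: power_mult_distrib)
  moreover have "w (n - 1) * w (n + 1)
      = frac_partition \<alpha> (n - 1) * frac_partition \<alpha> (n + 1) * (r ^ n) ^ 2"
    using \<open>n > 0\<close> by (cases n) (simp_all add: w_def power2_eq_square mult_ac)
  ultimately have "frac_partition \<alpha> (n - 1) * frac_partition \<alpha> (n + 1) * (r ^ n) ^ 2
      \<le> frac_partition \<alpha> n ^ 2 * (r ^ n) ^ 2"
    by (simp only: w_def power_mult_distrib)
  then show ?thesis
    using \<open>0 < r\<close> by simp
qed

section \<open>Estimates at the saddle point\<close>

lemma sums_sigma_inv_cis:
  fixes r u :: real
  assumes "0 \<le> r" "r < 1"
  defines "L \<equiv> (\<Sum>k. of_real (sigma_inv k) * (of_real r * cis u) ^ k)"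
  shows "(\<lambda>k. sigma_inv k * r ^ k * cos (real k * u)) sums Re L"
    and "(\<lambda>k. sigma_inv k * r ^ k * sin (real k * u)) sums Im L"
proof -
  have "summable (\<lambda>k. of_real (sigma_inv k) * (of_real r * cis u) ^ k)"
    using sums_sigma_inv_Ln[of "of_real r * cis u"] assms by (simp add: sums_iff norm_mult)
  then have "(\<lambda>k. of_real (sigma_inv k) * (of_real r * cis u) ^ k) sums L"
    unfolding L_def by (rule summable_sums)
  moreover have "of_real (sigma_inv k) * (of_real r * cis u) ^ k
      = of_real (sigma_inv k * r ^ k) * cis (real k * u)" for k
    by (simp add: power_mult_distrib Complex.DeMoivre)
  ultimately have "(\<lambda>k. of_real (sigma_inv k * r ^ k) * cis (real k * u)) sums L"
    by simp
  from sums_Re[OF this] sums_Im[OF this]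
  show "(\<lambda>k. sigma_inv k * r ^ k * cos (real k * u)) sums Re L"
    and "(\<lambda>k. sigma_inv k * r ^ k * sin (real k * u)) sums Im L"
    by simp_all
qed

text \<open>Polar form: a factor independent of u, a damping factor, and the cosine of a phase.
  Damping and phase are estimated separately below.\<close>

lemma Re_frac_partition_gf_cis:
  fixes \<alpha> r u y :: real
  assumes "0 \<le> r" "r < 1"
  shows "Re (frac_partition_gf \<alpha> (of_real r * cis u) * cis (- y)) =
    exp (\<alpha> * (\<Sum>k. sigma_inv k * r ^ k)) *
    (exp (- (\<alpha> * (\<Sum>k. sigma_inv k * r ^ k * (1 - cos (real k * u))))) *
      cos (\<alpha> * (\<Sum>k. sigma_inv k * r ^ k * sin (real k * u)) - y))"
proof -
  define L where "L = (\<Sum>k. of_real (sigma_inv k) * (of_real r * cis u) ^ k)"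
  have gf: "frac_partition_gf \<alpha> (of_real r * cis u) = exp (of_real \<alpha> * L)"
    using assms by (subst frac_partition_gf_eq_exp_sigma_inv) (simp_all add: norm_mult L_def)
  have re: "(\<lambda>k. sigma_inv k * r ^ k * cos (real k * u)) sums Re L"
    and im: "(\<lambda>k. sigma_inv k * r ^ k * sin (real k * u)) sums Im L"
    unfolding L_def using assms by (rule sums_sigma_inv_cis)+
  have "(\<lambda>k. sigma_inv k * r ^ k) sums (\<Sum>k. sigma_inv k * r ^ k)"
    using summable_sigma_inv_moment[of r 0] assms by (intro summable_sums) simp
  from sums_diff[OF this re]
  have "(\<Sum>k. sigma_inv k * r ^ k * (1 - cos (real k * u))) = (\<Sum>k. sigma_inv k * r ^ k) - Re L"
    by (simp add: sums_iff algebra_simps)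
  moreover have "(\<Sum>k. sigma_inv k * r ^ k * sin (real k * u)) = Im L"
    using im by (simp add: sums_iff)
  moreover have "Re (exp (of_real \<alpha> * L) * cis (- y)) = exp (\<alpha> * Re L) * cos (\<alpha> * Im L - y)"
    by (simp add: exp_eq_polar Re_exp Im_exp cos_diff algebra_simps)
  ultimately show ?thesis
    unfolding gf by (simp add: mult.assoc[symmetric] flip: exp_add)
      (simp add: algebra_simps)
qed

section \<open>Upper bounds for damping and phase\<close>

lemma one_minus_cos_le: "1 - cos x \<le> x ^ 2 / (2::real)"
proof -
  have "1 - cos x = 2 * sin (x / 2) ^ 2"
    using cos_double_sin[of "x / 2"] by simp
  also have "sin (x / 2) ^ 2 \<le> (x / 2) ^ 2"
    using abs_sin_x_le_abs_x[of "x / 2"] by (simp only: abs_le_square_iff)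
  finally show ?thesis by (simp add: power_divide)
qed

lemma abs_sin_minus_self_le: "\<bar>sin x - x\<bar> \<le> \<bar>x\<bar> ^ 3 / (6::real)"
proof -
  have "(\<Sum>m<3. sin_coeff m * x ^ m) = x"
    by (simp add: numeral_3_eq_3 sin_coeff_def)
  then show ?thesis
    using Maclaurin_sin_bound[of x 3] by (simp add: fact_numeral)
qed

lemma sigma_inv_moment_le:
  assumes "t > 0"
  shows "(\<Sum>k. real k * sigma_inv k * exp (- t) ^ k) \<le> 33 / (20 * t ^ 2)"
    and "(\<Sum>k. real k ^ 2 * sigma_inv k * exp (- t) ^ k) \<le> 33 / (10 * t ^ 3)"
    and "(\<Sum>k. real k ^ 3 * sigma_inv k * exp (- t) ^ k) \<le> 231 / (20 * t ^ 4)"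
proof -
  have *: "(\<Sum>k. real k ^ j * sigma_inv k * exp (- t) ^ k) \<le> 33 / 20 * C / t ^ Suc j"
    if "\<And>s M. s > 0 \<Longrightarrow> (\<Sum>m=1..M. real m ^ j * exp (- s) ^ m) \<le> C / s ^ Suc j"
      and "C \<ge> 0" "0 < j" "j \<le> 3" for C j
    using that assms
    by (intro suminf_le_const summable_sigma_inv_moment sum_power_sigma_inv_exp_le) auto
  show "(\<Sum>k. real k * sigma_inv k * exp (- t) ^ k) \<le> 33 / (20 * t ^ 2)"
    using *[OF sum_power1_exp_le] by (simp add: power2_eq_square)
  show "(\<Sum>k. real k ^ 2 * sigma_inv k * exp (- t) ^ k) \<le> 33 / (10 * t ^ 3)"
    using *[OF sum_power2_exp_le] by (simp add: eval_nat_numeral)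
  show "(\<Sum>k. real k ^ 3 * sigma_inv k * exp (- t) ^ k) \<le> 231 / (20 * t ^ 4)"
    using *[OF sum_power3_exp_le] by (simp add: eval_nat_numeral)
qed

lemma summable_sigma_inv_one_minus_cos:
  assumes "0 \<le> r" "r < 1"
  shows "summable (\<lambda>k. sigma_inv k * r ^ k * (1 - cos (real k * u)))"
proof -
  have "summable (\<lambda>k. sigma_inv k * r ^ k - sigma_inv k * r ^ k * cos (real k * u))"
    using summable_sigma_inv_moment[of r 0] sums_sigma_inv_cis(1)[of r u] assms
    by (intro summable_diff) (auto simp: sums_iff)
  then show ?thesis by (simp add: algebra_simps)
qed

text \<open>By 1 - cos x \<le> x^2/2 this is half of the second-moment bound.\<close>

lemma sigma_inv_cos_le:
  assumes "t > 0"
  shows "(\<Sum>k. sigma_inv k * exp (- t) ^ k * (1 - cos (real k * u))) \<le> 33 / 20 * u ^ 2 / t ^ 3"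
proof -
  have summ: "summable (\<lambda>k. real k ^ 2 * sigma_inv k * exp (- t) ^ k)"
    using assms by (intro summable_sigma_inv_moment) auto
  have "(\<Sum>k. sigma_inv k * exp (- t) ^ k * (1 - cos (real k * u)))
      \<le> (\<Sum>k. real k ^ 2 * sigma_inv k * exp (- t) ^ k * (u ^ 2 / 2))"
  proof (rule suminf_le)
    fix k
    have "sigma_inv k * exp (- t) ^ k * (1 - cos (real k * u)) \<le> sigma_inv k * exp (- t) ^ k * ((real k * u) ^ 2 / 2)"
      by (intro mult_left_mono one_minus_cos_le) (simp add: sigma_inv_nonneg)
    then show "sigma_inv k * exp (- t) ^ k * (1 - cos (real k * u))
        \<le> real k ^ 2 * sigma_inv k * exp (- t) ^ k * (u ^ 2 / 2)"
      by (simp add: power_mult_distrib mult_ac)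
  qed (use assms summ in \<open>auto intro!: summable_sigma_inv_one_minus_cos summable_mult2\<close>)
  also have "\<dots> = (\<Sum>k. real k ^ 2 * sigma_inv k * exp (- t) ^ k) * (u ^ 2 / 2)"
    using summ by (rule suminf_mult2[symmetric])
  also have "\<dots> \<le> 33 / (10 * t ^ 3) * (u ^ 2 / 2)"
    using assms by (intro mult_right_mono sigma_inv_moment_le) auto
  finally show ?thesis by simp
qed

text \<open>The subtracted linear term equals n u/\<alpha> at the saddle point, so the remaining
  phase is cubic in u. The constant is a sixth of the third-moment constant: 231/20/6 =
  77/40.\<close>

lemma sigma_inv_sin_le:
  assumes "t > 0" "u \<ge> 0"
  shows "\<bar>(\<Sum>k. sigma_inv k * exp (- t) ^ k * sin (real k * u))
      - u * (\<Sum>k. real k * sigma_inv k * exp (- t) ^ k)\<bar> \<le> 77 / 40 * u ^ 3 / t ^ 4"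
proof -
  define a where "a k = sigma_inv k * exp (- t) ^ k" for k
  have a: "a k \<ge> 0" for k by (simp add: a_def sigma_inv_nonneg)
  have 1: "summable (\<lambda>k. real k * a k)" and 3: "summable (\<lambda>k. real k ^ 3 * a k)"
    using summable_sigma_inv_moment[of "exp (- t)" 1] summable_sigma_inv_moment[of "exp (- t)" 3] assms
    by (simp_all add: a_def mult.assoc)
  have s: "summable (\<lambda>k. a k * sin (real k * u))"
    using sums_sigma_inv_cis(2)[of "exp (- t)" u] assms by (auto simp: a_def sums_iff)
  have "(\<Sum>k. a k * sin (real k * u)) - u * (\<Sum>k. real k * a k) = (\<Sum>k. a k * (sin (real k * u) - real k * u))"
  proof -
    have "(\<lambda>k. a k * sin (real k * u) - u * (real k * a k)) sums ((\<Sum>k. a k * sin (real k * u)) - u * (\<Sum>k. real k * a k))"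
      by (intro sums_diff sums_mult summable_sums s 1)
    then show ?thesis by (simp add: sums_iff algebra_simps)
  qed
  also have "\<bar>\<dots>\<bar> \<le> (\<Sum>k. real k ^ 3 * a k * (u ^ 3 / 6))"
  proof (rule order_trans[OF summable_rabs])
    have le: "\<bar>a k * (sin (real k * u) - real k * u)\<bar> \<le> real k ^ 3 * a k * (u ^ 3 / 6)" for k
    proof -
      have "\<bar>a k * (sin (real k * u) - real k * u)\<bar> \<le> a k * (\<bar>real k * u\<bar> ^ 3 / 6)"
        unfolding abs_mult[of "a k"] abs_of_nonneg[OF a]
        by (intro mult_left_mono abs_sin_minus_self_le a)
      then show ?thesis using assms by (simp add: power_mult_distrib abs_mult mult_ac)
    qed
    show *: "summable (\<lambda>k. \<bar>a k * (sin (real k * u) - real k * u)\<bar>)"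
      using le by (intro summable_comparison_test'[OF summable_mult2[OF 3, of "u ^ 3 / 6"]]) simp
    show "(\<Sum>k. \<bar>a k * (sin (real k * u) - real k * u)\<bar>) \<le> (\<Sum>k. real k ^ 3 * a k * (u ^ 3 / 6))"
      using le by (intro suminf_le * summable_mult2 3)
  qed
  also have "\<dots> = (\<Sum>k. real k ^ 3 * a k) * (u ^ 3 / 6)"
    using 3 by (rule suminf_mult2[symmetric])
  also have "\<dots> \<le> 231 / (20 * t ^ 4) * (u ^ 3 / 6)"
    using sigma_inv_moment_le(3)[OF \<open>t > 0\<close>] assms
    by (intro mult_right_mono) (auto simp: a_def mult.assoc)
  finally show ?thesis by (simp add: a_def mult.assoc)
qed

section \<open>Lower bound for the damping\<close>

lemma tanh_bound:
  assumes "t \<ge> (0::real)"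
  shows "2 * (1 - exp (- t)) \<le> t * (1 + exp (- t))"
proof -
  \<comment> \<open>The claim is tanh(t/2) \<le> t/2 with denominators cleared; f vanishes at 0 and
    has derivative 1 - (1 + x) exp(-x) \<ge> 0.\<close>
  define f where "f t = t * (1 + exp (- t)) - 2 * (1 - exp (- t))" for t :: real
  have "f 0 \<le> f t"
  proof (rule DERIV_nonneg_imp_nondecreasing[OF assms])
    fix x :: real assume "0 \<le> x"
    have "(f has_real_derivative (1 - (1 + x) * exp (- x))) (at x)"
      unfolding f_def by (auto intro!: derivative_eq_intros simp: algebra_simps)
    moreover have "(1 + x) * exp (- x) \<le> exp x * exp (- x)"
      by (intro mult_right_mono exp_ge_add_one_self) auto
    then have "0 \<le> 1 - (1 + x) * exp (- x)" by (simp flip: exp_add)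
    ultimately show "\<exists>y. (f has_real_derivative y) (at x) \<and> 0 \<le> y" by blast
  qed
  then show ?thesis by (simp add: f_def)
qed

text \<open>The geometric series at r minus the real part of the one at r e^(iu). The second factor
  of the denominator is the squared modulus of 1 - r e^(iu).\<close>

lemma sums_power_one_minus_cos:
  assumes "0 < r" "r < (1::real)"
  shows "(\<lambda>k. r ^ k * (1 - cos (real k * u))) sums
    (r * (1 - cos u) * (1 + r) / ((1 - r) * ((1 - r) ^ 2 + 2 * r * (1 - cos u))))"
proof -
  define c d where "c = 1 - cos u" and "d = 1 - r"
  have c: "c \<ge> 0" by (simp add: c_def)
  have d: "d > 0" using assms by (simp add: d_def)
  have sq: "(1 - r * cos u) ^ 2 + (r * sin u) ^ 2 = d ^ 2 + 2 * r * c"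
  proof -
    have "(r * sin u) ^ 2 = r ^ 2 * (1 - cos u ^ 2)"
      by (simp add: power_mult_distrib sin_squared_eq)
    then show ?thesis
      by (simp add: c_def d_def power2_eq_square algebra_simps)
  qed
  have pos: "d ^ 2 + 2 * r * c > 0"
    using c d assms by (intro add_pos_nonneg) auto
  have "(\<lambda>k. (of_real r * cis u) ^ k) sums (1 / (1 - of_real r * cis u))"
    using assms by (intro geometric_sums) (simp add: norm_mult)
  from sums_Re[OF this]
  have "(\<lambda>k. r ^ k * cos (real k * u)) sums Re (1 / (1 - of_real r * cis u))"
    by (simp add: power_mult_distrib Complex.DeMoivre flip: of_real_power)
  also have "Re (1 / (1 - of_real r * cis u)) = (1 - r * cos u) / (d ^ 2 + 2 * r * c)"
    unfolding sq[symmetric] by (simp add: Re_divide)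
  finally have "(\<lambda>k. r ^ k - r ^ k * cos (real k * u)) sums (1 / d - (1 - r * cos u) / (d ^ 2 + 2 * r * c))"
    using geometric_sums[of r] assms by (intro sums_diff) (simp_all add: d_def)
  also have "1 / d - (1 - r * cos u) / (d ^ 2 + 2 * r * c) = r * c * (1 + r) / (d * (d ^ 2 + 2 * r * c))"
  proof -
    have "1 * (d ^ 2 + 2 * r * c) - (1 - r * cos u) * d = r * c * (1 + r)"
      by (simp add: c_def d_def power2_eq_square algebra_simps)
    then show ?thesis
      using d pos by (subst diff_frac_eq) (auto simp: mult.commute)
  qed
  finally show ?thesis by (simp only: c_def d_def right_diff_distrib mult_1_right)
qed

text \<open>Since \<open>sigma_inv k\<close> is at least 1 for k > 0, the sum dominates the series
  of \<open>sums_power_one_minus_cos\<close>. In terms of v that series equals v/(1 + v) times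
  coth(t/2)/2, and coth(t/2) \<ge> 2/t.\<close>

lemma sigma_inv_cos_ge:
  fixes t u :: real
  assumes "t > 0"
  defines "v \<equiv> (sin (u / 2) / sinh (t / 2)) ^ 2"
  shows "v / (1 + v) / t \<le> (\<Sum>k. sigma_inv k * exp (- t) ^ k * (1 - cos (real k * u)))"
proof -
  define r where "r = exp (- t)"
  have r: "0 < r" "r < 1" using assms by (auto simp: r_def)
  define c d where "c = 1 - cos u" and "d = 1 - r"
  have c: "c \<ge> 0" by (simp add: c_def)
  have d: "d > 0" using r by (simp add: d_def)
  have v0: "v \<ge> 0" by (simp add: v_def)
  have "c = 2 * sin (u / 2) ^ 2"
    using cos_double_sin[of "u / 2"] by (simp add: c_def)
  moreover have "d ^ 2 = 4 * r * sinh (t / 2) ^ 2"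
    unfolding d_def r_def one_minus_exp_eq_sinh
    by (simp add: power_mult_distrib flip: exp_of_nat_mult)
  ultimately have v: "v = 2 * r * c / d ^ 2"
    using r assms by (simp add: v_def power_divide)
  have "v / (1 + v) / t \<le> v / (1 + v) * ((1 + r) / (2 * d))"
  proof -
    have "1 / t \<le> (1 + r) / (2 * d)"
      using tanh_bound[of t] assms d by (simp add: r_def d_def divide_simps mult.commute)
    then show ?thesis
      using mult_left_mono[of "1 / t" "(1 + r) / (2 * d)" "v / (1 + v)"] v0 by simp
  qed
  also have "\<dots> = r * c * (1 + r) / (d * (d ^ 2 + 2 * r * c))"
  proof -
    define Q where "Q = d ^ 2 + 2 * r * c"
    have Q: "Q > 0" unfolding Q_def using c d r by (intro add_pos_nonneg) auto
    have eq: "v / (1 + v) = 2 * r * c / Q"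
      using d Q unfolding v Q_def by (simp add: divide_simps)
    show ?thesis
      unfolding eq Q_def[symmetric] using d Q by (simp add: divide_simps)
  qed
  also have "\<dots> \<le> (\<Sum>k. sigma_inv k * r ^ k * (1 - cos (real k * u)))"
  proof (rule sums_le)
    show "(\<lambda>k. r ^ k * (1 - cos (real k * u))) sums (r * c * (1 + r) / (d * (d ^ 2 + 2 * r * c)))"
      unfolding c_def d_def using r by (rule sums_power_one_minus_cos)
    show "(\<lambda>k. sigma_inv k * r ^ k * (1 - cos (real k * u))) sums (\<Sum>k. sigma_inv k * r ^ k * (1 - cos (real k * u)))"
      using r by (intro summable_sums summable_sigma_inv_one_minus_cos) auto
    show "r ^ k * (1 - cos (real k * u)) \<le> sigma_inv k * r ^ k * (1 - cos (real k * u))" for k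
    proof (cases "k = 0")
      case False
      then have "1 * (r ^ k * (1 - cos (real k * u))) \<le> sigma_inv k * (r ^ k * (1 - cos (real k * u)))"
        using r by (intro mult_right_mono sigma_inv_ge_1) auto
      then show ?thesis by (simp add: mult.assoc)
    qed simp
  qed
  finally show ?thesis by (simp add: r_def)
qed

lemma saddle_point_exists:
  assumes "\<alpha> \<ge> 1" "n > 0"
  obtains t where "t > 0" "\<alpha> * (\<Sum>k. real k * sigma_inv k * exp (- t) ^ k) = real n"
proof -
  define \<phi> where "\<phi> x = (\<Sum>k. (real k * sigma_inv k) * x ^ k)" for x :: real
  \<comment> \<open>Chosen so that the geometric series r1/(1 - r1) equals n. As k
    \<open>sigma_inv k\<close> \<ge> 1 for k > 0 and \<alpha> \<ge> 1, the function \<alpha> \<phi>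
    reaches n on [0, r1], and the intermediate value theorem applies.\<close>
  define r1 where "r1 = real n / (real n + 1)"
  have r1: "0 < r1" "r1 < 1" using assms by (auto simp: r1_def)
  have summ: "summable (\<lambda>k. real k * sigma_inv k * x ^ k)" if "0 \<le> x" "x < 1" for x
    using summable_sigma_inv_moment[of x 1] that by simp
  have cont: "isCont \<phi> x" if "0 \<le> x" "x \<le> r1" for x
    unfolding \<phi>_def
    by (rule isCont_powser[of _ "(1 + r1) / 2"]) (use that r1 in \<open>auto intro!: summ\<close>)
  have A: "(\<lambda>k. r1 ^ Suc k) sums (r1 / (1 - r1))"
    using sums_mult[OF geometric_sums[of r1], of r1] r1 by simp
  have B: "(\<lambda>k. real (Suc k) * sigma_inv (Suc k) * r1 ^ Suc k) sums \<phi> r1"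
    using summable_sums[OF summ[of r1]] r1 by (subst sums_Suc_iff) (simp add: \<phi>_def)
  have "r1 ^ Suc k \<le> real (Suc k) * sigma_inv (Suc k) * r1 ^ Suc k" for k
  proof -
    have "1 * 1 \<le> real (Suc k) * sigma_inv (Suc k)"
      by (intro mult_mono sigma_inv_ge_1) (auto simp del: One_nat_def)
    then have "1 * r1 ^ Suc k \<le> real (Suc k) * sigma_inv (Suc k) * r1 ^ Suc k"
      using r1 by (intro mult_right_mono) auto
    then show ?thesis by (simp only: mult_1)
  qed
  then have "r1 / (1 - r1) \<le> \<phi> r1"
    using A B by (rule sums_le)
  moreover have "r1 / (1 - r1) = real n"
    by (simp add: r1_def field_simps)
  ultimately have "real n \<le> \<phi> r1" by simp
  then have ge: "real n \<le> \<alpha> * \<phi> r1"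
    using mult_mono[of 1 \<alpha> "real n" "\<phi> r1"] assms by simp
  have "\<exists>x\<ge>0. x \<le> r1 \<and> \<alpha> * \<phi> x = real n"
  proof (rule IVT)
    show "\<alpha> * \<phi> 0 \<le> real n" by (simp add: \<phi>_def)
    show "\<forall>x. 0 \<le> x \<and> x \<le> r1 \<longrightarrow> isCont (\<lambda>a. \<alpha> * \<phi> a) x"
      using cont by (auto intro!: continuous_intros)
  qed (use r1 ge in auto)
  then obtain x where x: "0 \<le> x" "x \<le> r1" "\<alpha> * \<phi> x = real n" by blast
  have "x \<noteq> 0"
    using x(3) assms by (auto simp: \<phi>_def)
  then have "exp (- (- ln x)) = x" "- ln x > 0"
    using x r1 by auto
  then show ?thesis
    using that[of "- ln x"] x by (simp add: \<phi>_def)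
qed

section \<open>Gaussian comparison\<close>

lemma sum_le_exp:
  assumes "x \<ge> (0::real)"
  shows "(\<Sum>k<n. x ^ k / fact k) \<le> exp x"
proof -
  have "(\<lambda>k. x ^ k / fact k) sums exp x"
    using exp_converges[of x] by (simp add: divide_inverse mult.commute)
  then show ?thesis
    using assms sum_le_suminf[of "\<lambda>k. x ^ k / fact k" "{..<n}"] by (auto simp: sums_iff)
qed

text \<open>The m-th power of exp y \<ge> e y at y = x/m, with 27/10 < e.\<close>

lemma exp_ge_power:
  assumes "x \<ge> (0::real)" "m > 0"
  shows "(27 / 10 * x / real m) ^ m \<le> exp x"
proof -
  have "27 / 10 \<le> exp (1::real)"
    using sum_le_exp[of 1 6] by (simp add: eval_nat_numeral)
  moreover have "x / real m \<le> exp (x / real m - 1)"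
    using exp_ge_add_one_self[of "x / real m - 1"] by simp
  ultimately have "27 / 10 * (x / real m) \<le> exp 1 * exp (x / real m - 1)"
    using assms by (intro mult_mono) auto
  also have "\<dots> = exp (x / real m)" by (simp flip: exp_add)
  finally have "(27 / 10 * (x / real m)) ^ m \<le> exp (x / real m) ^ m"
    using assms by (intro power_mono) auto
  also have "\<dots> = exp x" using assms by (simp flip: exp_of_nat_mult)
  finally show ?thesis by simp
qed

text \<open>With x = 1/s, so that x^2 \<ge> 70, \<open>exp_ge_power\<close> at m = 10 and m = 20
  bounds the exponentials below by multiples of x^20 and x^40, whose surplus powers of x absorb the
  constants. The rates 199/1000 and 499/1000 are those of the damping on [t/2, t] and on
  [t, pi].\<close>

lemma exp_minus_le_power:
  fixes s :: real
  assumes "0 < s" "s ^ 2 \<le> 1 / 70"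
  shows "exp (- (199 / 1000 / s ^ 2)) \<le> s ^ 3 / 250"
    and "exp (- (499 / 1000 / s ^ 2)) \<le> s ^ 9 / 1000"
proof -
  define x where "x = 1 / s"
  have x0: "x > 0" using assms by (simp add: x_def)
  have sq: "70 \<le> x ^ 2" using assms by (simp add: x_def field_simps)
  then have "8 ^ 2 \<le> x ^ 2" by simp
  then have x: "8 \<le> x" using x0 by (simp only: power_mono_iff)
  have "250 * x ^ 3 \<le> exp (199 / 1000 * x ^ 2)"
  proof -
    have "250 * 20 ^ 10 \<le> (8 * 70 ^ 8 :: real)" by simp
    also have "\<dots> \<le> x * (x ^ 2) ^ 8"
      using x sq by (intro mult_mono power_mono) auto
    also have "\<dots> = x ^ 17" by (simp flip: power_mult power_Suc)
    finally have "250 * 20 ^ 10 * x ^ 3 \<le> x ^ 17 * x ^ 3"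
      using x by (intro mult_right_mono) auto
    then have "250 * x ^ 3 \<le> x ^ 20 / 20 ^ 10"
      by (simp add: field_simps flip: power_add)
    also have "\<dots> = (x ^ 2 / 20) ^ 10"
      by (simp add: power_divide flip: power_mult)
    also have "\<dots> \<le> (27 / 10 * (199 / 1000 * x ^ 2) / real 10) ^ 10"
      by (intro power_mono) auto
    also have "\<dots> \<le> exp (199 / 1000 * x ^ 2)"
      by (intro exp_ge_power) auto
    finally show ?thesis .
  qed
  then show "exp (- (199 / 1000 / s ^ 2)) \<le> s ^ 3 / 250"
    using assms by (simp add: x_def exp_minus field_simps power_divide)
  have "1000 * x ^ 9 \<le> exp (499 / 1000 * x ^ 2)"
  proof -
    have "1000 * 15 ^ 20 \<le> (8 * 70 ^ 15 :: real)" by simp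
    also have "\<dots> \<le> x * (x ^ 2) ^ 15"
      using x sq by (intro mult_mono power_mono) auto
    also have "\<dots> = x ^ 31" by (simp flip: power_mult power_Suc)
    finally have "1000 * 15 ^ 20 * x ^ 9 \<le> x ^ 31 * x ^ 9"
      using x by (intro mult_right_mono) auto
    then have "1000 * x ^ 9 \<le> x ^ 40 / 15 ^ 20"
      by (simp add: field_simps flip: power_add)
    also have "\<dots> = (x ^ 2 / 15) ^ 20"
      by (simp add: power_divide flip: power_mult)
    also have "\<dots> \<le> (27 / 10 * (499 / 1000 * x ^ 2) / real 20) ^ 20"
      by (intro power_mono) auto
    also have "\<dots> \<le> exp (499 / 1000 * x ^ 2)"
      by (intro exp_ge_power) auto
    finally show ?thesis .
  qed
  then show "exp (- (499 / 1000 / s ^ 2)) \<le> s ^ 9 / 1000"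
    using assms by (simp add: x_def exp_minus field_simps power_divide)
qed

text \<open>A bootstrap: sinh y \<le> y cosh y is the tanh bound, the crude cosh(y/2) \<le> 2 then
  gives sinh(y/2) \<le> y, and so cosh y = 1 + 2 sinh^2(y/2) \<le> 1 + 2 y^2.\<close>

lemma sinh_le:
  assumes "0 \<le> y" "y \<le> (1/70::real)"
  shows "sinh y \<le> 10005 / 10000 * y"
proof -
  have le: "sinh y \<le> y * cosh y" if "y \<ge> 0" for y :: real
  proof -
    have "2 * sinh y * exp (- y) \<le> y * (1 + exp (- (2 * y)))"
      using tanh_bound[of "2 * y"] that one_minus_exp_eq_sinh[of "2 * y"] by simp
    also have "1 + exp (- (2 * y)) = 2 * cosh y * exp (- y)"
      by (simp add: cosh_field_def field_simps flip: exp_add)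
    finally show ?thesis by simp
  qed
  have "exp (y / 2) \<le> 2"
  proof -
    have "(y / 2) ^ 2 \<le> (1 / 140) ^ 2"
      using assms by (intro power_mono) auto
    then show ?thesis
      using exp_bound[of "y / 2"] assms by (simp add: power2_eq_square)
  qed
  moreover have "cosh (y / 2) \<le> exp (y / 2)"
    using assms by (simp add: cosh_def)
  ultimately have c: "cosh (y / 2) \<le> 2" by linarith
  have "sinh (y / 2) \<le> y"
    using le[of "y / 2"] mult_left_mono[OF c, of "y / 2"] assms by simp
  then have "sinh (y / 2) ^ 2 \<le> y ^ 2"
    using assms by (intro power_mono) auto
  also have "y ^ 2 \<le> (1 / 70) ^ 2"
    using assms by (intro power_mono) auto
  finally have "cosh y \<le> 10005 / 10000"
    using cosh_double[of "y / 2"] cosh_square_eq[of "y / 2"] by (simp add: power2_eq_square)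
  then show ?thesis
    using le[of y] mult_left_mono[of "cosh y" "10005 / 10000" y] assms by simp
qed

lemma sin_ge_small:
  assumes "0 \<le> y" "y \<le> (1/70::real)"
  shows "9999 / 10000 * y \<le> sin y"
proof -
  have "y ^ 3 = y * y ^ 2" by (simp add: power3_eq_cube power2_eq_square)
  also have "\<dots> \<le> y * (1 / 70) ^ 2"
    using assms by (intro mult_left_mono power_mono) auto
  finally show ?thesis
    using abs_sin_minus_self_le[of y] assms unfolding abs_le_iff by (simp add: power2_eq_square)
qed

text \<open>Makes the variable v of \<open>sigma_inv_cos_ge\<close> comparable with (u/t)^2, so that
  the damping is nearly Gaussian for small u.\<close>

lemma sin_div_sinh_ge:
  assumes "0 \<le> u" "u \<le> t" "0 < t" "t \<le> (1/35::real)"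
  shows "998 / 1000 * (u / t) ^ 2 \<le> (sin (u / 2) / sinh (t / 2)) ^ 2"
proof -
  have s: "9999 / 10000 * (u / 2) \<le> sin (u / 2)"
    using assms by (intro sin_ge_small) auto
  have sh: "sinh (t / 2) \<le> 10005 / 10000 * (t / 2)" "0 < sinh (t / 2)"
    using assms sinh_le[of "t / 2"] by auto
  have "9994 / 10000 * (u / t) \<le> 9999 / 10005 * (u / t)"
    using assms by (intro mult_right_mono) auto
  also have "\<dots> = (9999 / 10000 * (u / 2)) / (10005 / 10000 * (t / 2))"
    by simp
  also have "\<dots> \<le> sin (u / 2) / sinh (t / 2)"
    using s sh assms by (intro frac_le) auto
  finally have "(9994 / 10000 * (u / t)) ^ 2 \<le> (sin (u / 2) / sinh (t / 2)) ^ 2"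
    using assms by (intro power_mono) auto
  moreover have "998 / 1000 * (u / t) ^ 2 \<le> (9994 / 10000 * (u / t)) ^ 2"
    unfolding power_mult_distrib by (intro mult_right_mono) (auto simp: power2_eq_square)
  ultimately show ?thesis by linarith
qed

section \<open>Integrals bounded by explicit antiderivatives\<close>

lemma antiderivative_le_integral:
  fixes F G G' :: "real \<Rightarrow> real"
  assumes "a \<le> b" "F integrable_on {a..b}"
    and "\<And>u. u \<in> {a..b} \<Longrightarrow> (G has_real_derivative G' u) (at u)"
    and "\<And>u. u \<in> {a..b} \<Longrightarrow> G' u \<le> F u"
  shows "G b - G a \<le> integral {a..b} F"
proof -
  have "(G' has_integral (G b - G a)) {a..b}"
    using assms by (intro fundamental_theorem_of_calculus)
      (auto simp flip: has_real_derivative_iff_has_vector_derivative intro: has_field_derivative_at_within)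
  then show ?thesis
    using assms by (intro has_integral_le[OF _ integrable_integral]) auto
qed

lemma divide_one_plus_mono:
  assumes "0 \<le> a" "a \<le> (v::real)"
  shows "a / (1 + a) \<le> v / (1 + v)"
  using assms by (simp add: divide_simps algebra_simps)

lemma gaussian_main_part_le:
  fixes c :: real
  assumes "c > 0" and F: "F integrable_on {0..c}"
    and ge: "\<And>u. u \<in> {0..c} \<Longrightarrow> 97 / 200 * (u ^ 2 * exp (- (33 / 20 * (u / c) ^ 2))) \<le> F u"
  shows "61 / 1000 * c ^ 3 \<le> integral {0..c} F"
proof -
  \<comment> \<open>Integration by parts reduces \<open>x^2 exp (- Z x^2)\<close> to \<open>exp (- Z x^2)\<close>, which is replaced by its cubic
    Taylor polynomial in \<open>Z x^2\<close>, a lower bound.\<close>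
  define Z where "Z = (33 / 20 :: real)"
  define H where "H x = (x - Z * x ^ 3 / 3 + Z ^ 2 * x ^ 5 / 10 - Z ^ 3 * x ^ 7 / 42 - x * exp (- (Z * x ^ 2))) / (2 * Z)" for x
  define H' where "H' x = x ^ 2 * exp (- (Z * x ^ 2))
     + (1 - Z * x ^ 2 + (Z * x ^ 2) ^ 2 / 2 - (Z * x ^ 2) ^ 3 / 6 - exp (- (Z * x ^ 2))) / (2 * Z)" for x
  have Z: "Z > 0" by (simp add: Z_def)
  have dH: "(H has_real_derivative H' x) (at x)" for x
    unfolding H_def H'_def using Z
    by (auto intro!: derivative_eq_intros simp: field_simps eval_nat_numeral)
  have H'_le: "H' x \<le> x ^ 2 * exp (- (Z * x ^ 2))" for x
  proof -
    define y where "y = Z * x ^ 2"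
    have "y \<ge> 0" using Z by (simp add: y_def)
    have "1 - y + y ^ 2 / 2 - y ^ 3 / 6 \<le> exp (- y)"
    proof -
      \<comment> \<open>The sign of the Taylor remainder is found by repeated differentiation: f' =
        f1, f1' = f2 \<ge> 0, and f and f1 vanish at 0.\<close>
      define f where "f y = exp (- y) - (1 - y + y ^ 2 / 2 - y ^ 3 / 6)" for y :: real
      define f1 where "f1 y = 1 - y + y ^ 2 / 2 - exp (- y)" for y :: real
      define f2 where "f2 y = y - 1 + exp (- y)" for y :: real
      have f2: "f2 y \<ge> 0" for y
        using exp_ge_add_one_self[of "- y"] by (simp add: f2_def)
      have f1: "f1 0 \<le> f1 y" if "y \<ge> 0" for y
      proof (rule DERIV_nonneg_imp_nondecreasing[OF that])
        fix x :: real
        have "(f1 has_real_derivative f2 x) (at x)"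
          unfolding f1_def f2_def by (auto intro!: derivative_eq_intros)
        with f2 show "\<exists>y. (f1 has_real_derivative y) (at x) \<and> 0 \<le> y" by blast
      qed
      have "f 0 \<le> f y"
      proof (rule DERIV_nonneg_imp_nondecreasing[OF \<open>y \<ge> 0\<close>])
        fix x :: real assume "0 \<le> x"
        have "(f has_real_derivative f1 x) (at x)"
          unfolding f_def f1_def by (auto intro!: derivative_eq_intros simp: field_simps)
        moreover have "f1 x \<ge> 0" using f1[OF \<open>0 \<le> x\<close>] by (simp add: f1_def)
        ultimately show "\<exists>y. (f has_real_derivative y) (at x) \<and> 0 \<le> y" by blast
      qed
      then show ?thesis by (simp add: f_def)
    qed
    then have "(1 - y + y ^ 2 / 2 - y ^ 3 / 6 - exp (- y)) / (2 * Z) \<le> 0"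
      using Z by (simp add: divide_le_0_iff)
    then show ?thesis by (simp add: H'_def y_def)
  qed
  \<comment> \<open>The substitution x = u/c; the factor c^3 comes from u^2 du.\<close>
  define G where "G u = 97 / 200 * c ^ 3 * H (u / c)" for u
  have "G c - G 0 \<le> integral {0..c} F"
  proof (rule antiderivative_le_integral)
    fix u assume u: "u \<in> {0..c}"
    show "(G has_real_derivative 97 / 200 * c ^ 2 * H' (u / c)) (at u)"
      unfolding G_def using assms(1)
      by (auto intro!: derivative_eq_intros DERIV_chain2[where f = H, OF dH] simp: field_simps eval_nat_numeral)
    have "97 / 200 * c ^ 2 * H' (u / c) \<le> 97 / 200 * c ^ 2 * ((u / c) ^ 2 * exp (- (Z * (u / c) ^ 2)))"
      by (intro mult_left_mono H'_le) auto
    also have "\<dots> = 97 / 200 * (u ^ 2 * exp (- (33 / 20 * (u / c) ^ 2)))"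
      using assms(1) by (simp add: Z_def power_divide)
    finally show "97 / 200 * c ^ 2 * H' (u / c) \<le> F u"
      using ge[OF u] by linarith
  qed (use assms in auto)
  moreover have "G 0 = 0" by (simp add: G_def H_def)
  moreover have "127 / 1000 \<le> H 1"
  proof -
    have "517 / 100 \<le> exp (33 / 20 :: real)"
      using sum_le_exp[of "33 / 20" 6] by (simp add: eval_nat_numeral)
    then have "exp (- (33 / 20)) \<le> (100 / 517 :: real)"
      by (simp add: exp_minus field_simps)
    then show ?thesis by (simp add: H_def Z_def eval_nat_numeral field_simps)
  qed
  then have "97 / 200 * c ^ 3 * (127 / 1000) \<le> G c"
    unfolding G_def using assms(1) by (intro mult_left_mono) auto
  moreover have "61 / 1000 * c ^ 3 \<le> 97 / 200 * c ^ 3 * (127 / 1000)"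
    using assms(1) by simp
  ultimately show ?thesis by linarith
qed

lemma gaussian_tail_ge:
  fixes c b :: real
  assumes "c > 0" "93 / 50 * c \<le> b" and F: "F integrable_on {93 / 50 * c..b}"
    and ge: "\<And>u. u \<in> {93 / 50 * c..b} \<Longrightarrow> - (u ^ 2 / 2 * exp (- (79 / 100 * (u / c) ^ 2))) \<le> F u"
  shows "- (5 / 100 * c ^ 3) \<le> integral {93 / 50 * c..b} F"
proof -
  \<comment> \<open>Integration by parts, with the remaining Gaussian tail dominated by the next boundary term.\<close>
  define B where "B = (79 / 100 :: real)"
  define T where "T x = (x / (2 * B) + inverse x / (4 * B ^ 2)) * exp (- (B * x ^ 2))" for x
  define T' where "T' x = - (x ^ 2 + 1 / (4 * B ^ 2 * x ^ 2)) * exp (- (B * x ^ 2))" for x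
  have B: "B > 0" by (simp add: B_def)
  have dT: "(T has_real_derivative T' x) (at x)" if "x > 0" for x
  proof -
    have "(T has_real_derivative (1 / (2 * B) - inverse x ^ 2 / (4 * B ^ 2)) * exp (- (B * x ^ 2))
        - (x / (2 * B) + inverse x / (4 * B ^ 2)) * (2 * B * x * exp (- (B * x ^ 2)))) (at x)"
      unfolding T_def using that B
      by (auto intro!: derivative_eq_intros simp: power2_eq_square)
    also have "(1 / (2 * B) - inverse x ^ 2 / (4 * B ^ 2)) * exp (- (B * x ^ 2))
        - (x / (2 * B) + inverse x / (4 * B ^ 2)) * (2 * B * x * exp (- (B * x ^ 2))) = T' x"
      unfolding T'_def using that B by (simp add: field_simps power2_eq_square)
    finally show ?thesis .
  qed
  have T'_le: "T' x \<le> - (x ^ 2 * exp (- (B * x ^ 2)))" for x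
    unfolding T'_def minus_mult_left[symmetric] by (intro le_imp_neg_le mult_right_mono) auto
  define G where "G u = c ^ 3 / 2 * T (u / c)" for u
  have "G b - G (93 / 50 * c) \<le> integral {93 / 50 * c..b} F"
  proof (rule antiderivative_le_integral)
    fix u assume u: "u \<in> {93 / 50 * c..b}"
    then have "u / c > 0" using assms(1) by (auto intro!: divide_pos_pos simp: less_le_trans[of 0 "93 / 50 * c" u])
    show "(G has_real_derivative c ^ 2 / 2 * T' (u / c)) (at u)"
      unfolding G_def using assms(1)
      by (auto intro!: derivative_eq_intros DERIV_chain2[where f = T and g = "\<lambda>u. u / c" and x = u, OF dT[OF \<open>u / c > 0\<close>]] simp: field_simps eval_nat_numeral)
    have "c ^ 2 / 2 * T' (u / c) \<le> c ^ 2 / 2 * (- ((u / c) ^ 2 * exp (- (B * (u / c) ^ 2))))"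
      by (intro mult_left_mono T'_le) auto
    also have "\<dots> = - (u ^ 2 / 2 * exp (- (79 / 100 * (u / c) ^ 2)))"
      using assms(1) by (simp add: B_def power_divide)
    finally show "c ^ 2 / 2 * T' (u / c) \<le> F u"
      using ge[OF u] by linarith
  qed (use assms in auto)
  moreover have "G b \<ge> 0"
    unfolding G_def T_def using assms(1,2) B
    by (intro mult_nonneg_nonneg add_nonneg_nonneg divide_nonneg_nonneg) auto
  \<comment> \<open>The boundary term at the left end. With the factor 1/2 in G it accounts for the
    constant 5/100.\<close>
  moreover have "T (93 / 50) \<le> 1 / 10"
  proof -
    have "14 \<le> exp (2733 / 1000 :: real)"
      using sum_le_exp[of "2733 / 1000" 7] by (simp add: eval_nat_numeral)
    also have "\<dots> \<le> exp (79 / 100 * (93 / 50) ^ 2)"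
      by (simp add: power2_eq_square)
    finally have "exp (- (79 / 100 * (93 / 50) ^ 2)) \<le> (1 / 14 :: real)"
      by (simp add: exp_minus field_simps)
    then have "T (93 / 50) \<le> (93 / 50 / (2 * B) + inverse (93 / 50) / (4 * B ^ 2)) * (1 / 14)"
      unfolding T_def B_def by (intro mult_left_mono) auto
    also have "\<dots> \<le> 1 / 10" by (simp add: B_def power2_eq_square)
    finally show ?thesis .
  qed
  then have "G (93 / 50 * c) \<le> c ^ 3 / 2 * (1 / 10)"
    unfolding G_def using assms(1) by (intro mult_left_mono) auto
  ultimately show ?thesis by simp
qed

section \<open>Log-concavity and the theorem\<close>

text \<open>P is the damping exponent and A the phase. The range is cut at c, 93/50 c, t/2 and t,
  where c = t sqrt(t/\<alpha>) is the width of the Gaussian. In units of c^3/1000 the five pieces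
  contribute at least 61, 0, -50, -1 and -1, a positive total.\<close>

lemma oscillatory_integral_nonneg:
  fixes P A :: "real \<Rightarrow> real" and \<alpha> t :: real
  defines "F \<equiv> \<lambda>u. exp (- P u) * cos (A u) * (1 - cos u)"
  assumes \<alpha>: "\<alpha> \<ge> 2" and t: "0 < t" "t \<le> 1 / 35" "70 * t \<le> \<alpha>"
    and P_le: "\<And>u. 0 \<le> u \<Longrightarrow> P u \<le> 33 / 20 * \<alpha> * u ^ 2 / t ^ 3"
    and P_ge: "\<And>u v. 0 \<le> u \<Longrightarrow> v = (sin (u / 2) / sinh (t / 2)) ^ 2 \<Longrightarrow> \<alpha> / t * (v / (1 + v)) \<le> P u"
    and A_le: "\<And>u. 0 \<le> u \<Longrightarrow> \<bar>A u\<bar> \<le> 77 / 40 * \<alpha> * u ^ 3 / t ^ 4"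
    and int: "F integrable_on {0..pi}"
  shows "0 \<le> integral {0..pi} F"
proof -
  \<comment> \<open>In these units the hypotheses read P u \<le> 33/20 (u/c)^2 and |A u| \<le> 77/40
    s (u/c)^3. Thus s measures the phase at the Gaussian scale, and 70 t \<le> \<alpha> makes it at
    most 0.12.\<close>
  define s where "s = sqrt (t / \<alpha>)"
  define c where "c = t * s"
  have s: "0 < s" "s ^ 2 = t / \<alpha>" "s ^ 2 \<le> 1 / 70"
    using t \<alpha> by (auto simp: s_def field_simps)
  have "s ^ 2 \<le> (12 / 100) ^ 2"
    using s by (simp add: power2_eq_square)
  then have s_le: "s \<le> 12 / 100"
    by (rule power2_le_imp_le) simp
  have c: "0 < c" using s t by (simp add: c_def)
  have \<alpha>_eq: "\<alpha> = t / s ^ 2" using s t \<alpha> by simp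
  have c_le: "93 / 50 * c \<le> t / 2"
    using mult_left_mono[OF s_le, of t] t by (simp add: c_def)
  have t_pi: "t \<le> pi" using t pi_gt3 by simp
  have P_le': "P u \<le> 33 / 20 * (u / c) ^ 2" if "0 \<le> u" for u
    using P_le[OF that] t s(1)
    by (simp add: \<alpha>_eq c_def power_divide power_mult_distrib power2_eq_square power3_eq_cube mult_ac)
  have A_le': "\<bar>A u\<bar> \<le> 77 / 40 * s * (u / c) ^ 3" if "0 \<le> u" for u
    using A_le[OF that] t s(1)
    by (simp add: \<alpha>_eq c_def power_divide power_mult_distrib power2_eq_square power3_eq_cube power4_eq_xxxx mult_ac)
  \<comment> \<open>K is a lower bound for 1/(1 + a). As x/(1 + x) increases, K a is a lower bound
    for v/(1 + v), and \<alpha>/t = 1/s^2.\<close>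
  have P_ge': "K * a / s ^ 2 \<le> P u"
    if "0 \<le> u" "0 \<le> a" "a \<le> (sin (u / 2) / sinh (t / 2)) ^ 2" "K * (1 + a) \<le> 1" for u a K
  proof -
    define v where "v = (sin (u / 2) / sinh (t / 2)) ^ 2"
    have "K * a \<le> a / (1 + a)"
      using mult_left_mono[OF that(4,2)] that(2) by (simp add: pos_le_divide_eq mult_ac)
    also have "\<dots> \<le> v / (1 + v)"
      using that by (intro divide_one_plus_mono) (auto simp: v_def)
    finally have "1 / s ^ 2 * (K * a) \<le> 1 / s ^ 2 * (v / (1 + v))"
      by (intro mult_left_mono) auto
    also have "\<dots> \<le> P u"
      using P_ge[OF \<open>0 \<le> u\<close> v_def] t s(1) by (simp add: \<alpha>_eq)
    finally show ?thesis by simp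
  qed
  \<comment> \<open>The cosine of the phase is discarded here. The bound 1 - cos u \<le> u^2/2
    serves for u \<le> t, and 1 - cos u \<le> 2 serves on [t, pi].\<close>
  have F_ge: "- (u ^ 2 / 2 * exp (- p)) \<le> F u" "- (2 * exp (- p)) \<le> F u"
    if "p \<le> P u" for p u
  proof -
    have "\<bar>F u\<bar> = exp (- P u) * \<bar>cos (A u)\<bar> * (1 - cos u)"
      by (simp add: F_def abs_mult)
    also have "\<dots> \<le> exp (- p) * 1 * (1 - cos u)"
      using that by (intro mult_mono mult_nonneg_nonneg) auto
    finally have *: "\<bar>F u\<bar> \<le> exp (- p) * (1 - cos u)" by simp
    have "exp (- p) * (1 - cos u) \<le> exp (- p) * (u ^ 2 / 2)"
      by (intro mult_left_mono one_minus_cos_le) auto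
    with * show "- (u ^ 2 / 2 * exp (- p)) \<le> F u"
      unfolding mult.commute[of "u ^ 2 / 2"] by linarith
    have "exp (- p) * (1 - cos u) \<le> exp (- p) * 2"
      using cos_ge_minus_one[of u] by (intro mult_left_mono) auto
    with * show "- (2 * exp (- p)) \<le> F u"
      by linarith
  qed
  have sub: "F integrable_on {a..b}" if "0 \<le> a" "b \<le> pi" for a b
    using integrable_on_subinterval[OF int] that by auto

  \<comment> \<open>For u \<le> c the phase is at most 0.24, so its cosine is at least 0.971. With
    the loss 0.9998 in 1 - cos u, the factor 1/2 shrinks to no less than 97/200.\<close>
  have I1: "61 / 1000 * c ^ 3 \<le> integral {0..c} F"
  proof (rule gaussian_main_part_le[OF c sub])
    fix u assume u: "u \<in> {0..c}"
    have "u \<le> t" using u c_le c t by auto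
    have "\<bar>A u\<bar> \<le> 77 / 40 * s * (u / c) ^ 3" using u by (intro A_le') auto
    also have "\<dots> \<le> 77 / 40 * (12 / 100) * 1 ^ 3"
      using s s_le u c by (intro mult_mono power_mono) auto
    finally have "\<bar>A u\<bar> \<le> 24 / 100" by simp
    then have "\<bar>A u\<bar> ^ 2 \<le> (24 / 100) ^ 2"
      by (intro power_mono) auto
    then have cosA: "971 / 1000 \<le> cos (A u)"
      using one_minus_cos_le[of "A u"] by (simp add: power2_eq_square)
    have "9999 / 10000 * (u / 2) \<le> sin (u / 2)"
      using u \<open>u \<le> t\<close> t by (intro sin_ge_small) auto
    then have sin2: "(9999 / 10000 * (u / 2)) ^ 2 \<le> sin (u / 2) ^ 2"
      using u by (intro power_mono) auto
    have cosu: "9998 / 10000 * (u ^ 2 / 2) \<le> 1 - cos u"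
    proof -
      have "9998 / 10000 * (u ^ 2 / 2) \<le> 9999 ^ 2 / 10000 ^ 2 * (u ^ 2 / 2)"
        by (intro mult_right_mono) (auto simp: power2_eq_square)
      also have "\<dots> = 2 * (9999 / 10000 * (u / 2)) ^ 2"
        by (simp add: power_mult_distrib power_divide)
      also have "\<dots> \<le> 2 * sin (u / 2) ^ 2"
        using sin2 by (intro mult_left_mono) auto
      finally show ?thesis
        using cos_double_sin[of "u / 2"] by simp
    qed
    have "97 / 200 * (u ^ 2 * exp (- (33 / 20 * (u / c) ^ 2)))
        \<le> exp (- (33 / 20 * (u / c) ^ 2)) * (971 / 1000) * (9998 / 10000 * (u ^ 2 / 2))"
      using mult_nonneg_nonneg[of "exp (- (33 / 20 * (u / c) ^ 2))" "u ^ 2"] by simp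
    also have "\<dots> \<le> exp (- P u) * cos (A u) * (1 - cos u)"
      using P_le'[of u] u cosA cosu by (intro mult_mono mult_nonneg_nonneg) auto
    finally show "97 / 200 * (u ^ 2 * exp (- (33 / 20 * (u / c) ^ 2))) \<le> F u"
      by (simp add: F_def)
  qed (use c_le c t_pi in auto)

  \<comment> \<open>The endpoint 93/50 keeps the phase below 3/2 < pi/2, so the integrand is still
    nonnegative.\<close>
  have I2: "0 \<le> integral {c..93 / 50 * c} F"
  proof (rule integral_nonneg[OF sub])
    fix u assume u: "u \<in> {c..93 / 50 * c}"
    have "\<bar>A u\<bar> \<le> 77 / 40 * s * (u / c) ^ 3" using u c by (intro A_le') auto
    also have "\<dots> \<le> 77 / 40 * (12 / 100) * (93 / 50) ^ 3"
      using s s_le u c by (intro mult_mono power_mono) (auto simp: field_simps)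
    also have "\<dots> \<le> 3 / 2" by (simp add: eval_nat_numeral)
    finally have "\<bar>A u\<bar> \<le> 3 / 2" .
    then have "0 \<le> cos (A u)"
      using pi_gt3 by (intro cos_ge_zero) auto
    then show "0 \<le> F u" by (simp add: F_def)
  qed (use c c_le t_pi in auto)

  \<comment> \<open>For u \<le> t/2 the value a = 0.998 (u/t)^2 is below 1/4, which permits K =
    8/10. Then K times 0.998 exceeds 79/100, and (u/t)^2/s^2 = (u/c)^2.\<close>
  have I3: "- (5 / 100 * c ^ 3) \<le> integral {93 / 50 * c..t / 2} F"
  proof (rule gaussian_tail_ge[OF c c_le sub])
    fix u assume u: "u \<in> {93 / 50 * c..t / 2}"
    then have u': "0 \<le> u" "u \<le> t" using c t by auto
    have "(u / t) ^ 2 \<le> (1 / 2) ^ 2"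
      using u u' t by (intro power_mono) (auto simp: field_simps)
    then have "(u / t) ^ 2 \<le> 1 / 4" by (simp add: power2_eq_square)
    moreover have "8 / 10 * (1 + 998 / 1000 * x) \<le> 1" if "x \<le> 1 / 4" for x :: real
      using that by simp
    ultimately have "8 / 10 * (1 + 998 / 1000 * (u / t) ^ 2) \<le> 1" by blast
    then have "8 / 10 * (998 / 1000 * (u / t) ^ 2) / s ^ 2 \<le> P u"
      using u' t by (intro P_ge' sin_div_sinh_ge) auto
    moreover have "79 / 100 * (u / c) ^ 2 \<le> 8 / 10 * (998 / 1000 * (u / t) ^ 2) / s ^ 2"
      using t s by (simp add: c_def power_divide power_mult_distrib divide_simps)
    ultimately show "- (u ^ 2 / 2 * exp (- (79 / 100 * (u / c) ^ 2))) \<le> F u"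
      by (intro F_ge) simp
  qed (use c t_pi t in auto)

  have c3: "c ^ 3 = t ^ 3 * s ^ 3" by (simp add: c_def power_mult_distrib)
  \<comment> \<open>Now a = 0.998/4 with K = 8/10 gives P u \<ge> 0.199/s^2. The pointwise bound
    t^2/2 times s^3/250 on an interval of length t/2 amounts to c^3/1000.\<close>
  have I4: "- (1 / 1000 * c ^ 3) \<le> integral {t / 2..t} F"
  proof -
    have "- (t ^ 2 / 2 * (s ^ 3 / 250)) * t - - (t ^ 2 / 2 * (s ^ 3 / 250)) * (t / 2) \<le> integral {t / 2..t} F"
    proof (rule antiderivative_le_integral)
      fix u assume u: "u \<in> {t / 2..t}"
      show "((\<lambda>u. - (t ^ 2 / 2 * (s ^ 3 / 250)) * u) has_real_derivative - (t ^ 2 / 2 * (s ^ 3 / 250))) (at u)"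
        by (auto intro!: derivative_eq_intros)
      have "998 / 1000 * (1 / 2) ^ 2 \<le> 998 / 1000 * (u / t) ^ 2"
        using u t by (intro mult_left_mono power_mono) (auto simp: field_simps)
      also have "\<dots> \<le> (sin (u / 2) / sinh (t / 2)) ^ 2"
        using u t by (intro sin_div_sinh_ge) auto
      finally have "8 / 10 * (998 / 1000 * (1 / 2) ^ 2) / s ^ 2 \<le> P u"
        using u t by (intro P_ge') (auto simp: power2_eq_square)
      moreover have "199 / 1000 / s ^ 2 \<le> 8 / 10 * (998 / 1000 * (1 / 2) ^ 2) / s ^ 2"
        by (intro divide_right_mono) (auto simp: power2_eq_square)
      ultimately have "- (u ^ 2 / 2 * exp (- (199 / 1000 / s ^ 2))) \<le> F u"
        by (intro F_ge) simp
      moreover have "u ^ 2 / 2 * exp (- (199 / 1000 / s ^ 2)) \<le> t ^ 2 / 2 * (s ^ 3 / 250)"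
        using u t s by (intro mult_mono divide_right_mono power_mono exp_minus_le_power) auto
      ultimately show "- (t ^ 2 / 2 * (s ^ 3 / 250)) \<le> F u" by linarith
    qed (use t t_pi sub in auto)
    moreover have "- (t ^ 2 / 2 * (s ^ 3 / 250)) * t - - (t ^ 2 / 2 * (s ^ 3 / 250)) * (t / 2) = - (1 / 1000 * c ^ 3)"
      unfolding c3 by (simp add: power2_eq_square power3_eq_cube)
    ultimately show ?thesis by simp
  qed

  \<comment> \<open>On this range sin(u/2) is at least sin(t/2), so a = 0.998 with K = 1/2 is
    admissible. The interval is shorter than 4, and \<alpha> \<ge> 2 gives 2 s^2 \<le> t, which
    converts 8 s^9 into at most c^3.\<close>
  have I5: "- (1 / 1000 * c ^ 3) \<le> integral {t..pi} F"
  proof -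
    have "- (2 * (s ^ 9 / 1000)) * pi - - (2 * (s ^ 9 / 1000)) * t \<le> integral {t..pi} F"
    proof (rule antiderivative_le_integral)
      fix u assume u: "u \<in> {t..pi}"
      show "((\<lambda>u. - (2 * (s ^ 9 / 1000)) * u) has_real_derivative - (2 * (s ^ 9 / 1000))) (at u)"
        by (auto intro!: derivative_eq_intros)
      have "998 / 1000 * 1 ^ 2 \<le> (sin (t / 2) / sinh (t / 2)) ^ 2"
        using sin_div_sinh_ge[of t t] t by simp
      also have "\<dots> \<le> (sin (u / 2) / sinh (t / 2)) ^ 2"
        using u t t_pi by (intro power_mono divide_right_mono sin_monotone_2pi_le divide_nonneg_nonneg sin_ge_zero) auto
      finally have "1 / 2 * (998 / 1000 * 1 ^ 2) / s ^ 2 \<le> P u"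
        using u t by (intro P_ge') auto
      then have "- (2 * exp (- (499 / 1000 / s ^ 2))) \<le> F u"
        by (intro F_ge) simp
      then show "- (2 * (s ^ 9 / 1000)) \<le> F u"
        using exp_minus_le_power(2)[OF s(1,3)] by linarith
    qed (use t t_pi sub in auto)
    moreover have "8 * s ^ 9 \<le> c ^ 3"
    proof -
      have "2 * s ^ 2 \<le> t"
        using mult_right_mono[OF \<alpha>, of "s ^ 2"] s t \<alpha> by (simp add: mult.commute)
      then have "(2 * s ^ 2) ^ 3 * s ^ 3 \<le> t ^ 3 * s ^ 3"
        using s(1) by (intro mult_right_mono power_mono) auto
      moreover have "(2 * s ^ 2) ^ 3 * s ^ 3 = 8 * s ^ 9"
        by (simp add: power_mult_distrib eval_nat_numeral)
      ultimately show ?thesis unfolding c3 by (simp only:)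
    qed
    moreover have "2 * (s ^ 9 / 1000) * pi \<le> 2 * (s ^ 9 / 1000) * 4"
      using s pi_less_4 by (intro mult_left_mono) auto
    moreover have "0 \<le> 2 * (s ^ 9 / 1000) * t" using s t by simp
    ultimately show ?thesis by linarith
  qed

  have "integral {0..pi} F = integral {0..t} F + integral {t..pi} F"
    using t t_pi int by (intro Henstock_Kurzweil_Integration.integral_combine[symmetric]) auto
  also have "integral {0..t} F = integral {0..t / 2} F + integral {t / 2..t} F"
    using t t_pi sub by (intro Henstock_Kurzweil_Integration.integral_combine[symmetric]) auto
  also have "integral {0..t / 2} F = integral {0..93 / 50 * c} F + integral {93 / 50 * c..t / 2} F"
    using t t_pi sub c c_le by (intro Henstock_Kurzweil_Integration.integral_combine[symmetric]) auto
  also have "integral {0..93 / 50 * c} F = integral {0..c} F + integral {c..93 / 50 * c} F"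
    using t t_pi sub c c_le by (intro Henstock_Kurzweil_Integration.integral_combine[symmetric]) auto
  finally show ?thesis
    using I1 I2 I3 I4 I5 zero_le_power[of c 3] c by linarith
qed

lemma frac_partition_log_concave:
  fixes \<alpha> :: real and n :: nat
  assumes \<alpha>: "\<alpha> \<ge> 2" and n: "real n \<ge> 2 * \<alpha> ^ 11"
  shows "frac_partition \<alpha> (n - 1) * frac_partition \<alpha> (n + 1) \<le> frac_partition \<alpha> n ^ 2"
proof -
  have pow: "2 ^ k \<le> \<alpha> ^ k" for k using \<alpha> by (intro power_mono) auto
  have n0: "n > 0"
  proof -
    have "0 < 2 * \<alpha> ^ 11" using \<alpha> by simp
    with n have "0 < real n" by linarith
    then show ?thesis by simp
  qed
  obtain t where t: "t > 0" and saddle: "\<alpha> * (\<Sum>k. real k * sigma_inv k * exp (- t) ^ k) = real n"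
    using saddle_point_exists[of \<alpha> n] \<alpha> n0 by auto
  \<comment> \<open>The first-moment bound caps n by 33 \<alpha>/(20 t^2). With n \<ge> 2
    \<alpha>^11 and \<alpha> \<ge> 2 this forces 40960 t^2 \<le> 33, hence t \<le> 1/35.\<close>
  have "real n \<le> \<alpha> * (33 / (20 * t ^ 2))"
    unfolding saddle[symmetric] using \<alpha> t by (intro mult_left_mono sigma_inv_moment_le) auto
  with n have "2 * \<alpha> ^ 11 \<le> \<alpha> * (33 / (20 * t ^ 2))" by linarith
  then have "\<alpha> * (40 * \<alpha> ^ 10 * t ^ 2) \<le> \<alpha> * 33"
    using t by (simp add: field_simps eval_nat_numeral)
  then have t2: "40 * \<alpha> ^ 10 * t ^ 2 \<le> 33"
    using \<alpha> by simp
  have "40 * 2 ^ 10 * t ^ 2 \<le> 40 * \<alpha> ^ 10 * t ^ 2"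
    using pow[of 10] by (intro mult_right_mono mult_left_mono) auto
  also note t2
  finally have "t ^ 2 \<le> (1 / 35) ^ 2" by (simp add: power2_eq_square)
  then have t_le: "t \<le> 1 / 35" by (rule power2_le_imp_le) simp
  have t70: "70 * t \<le> \<alpha>" using t_le \<alpha> by simp
  define r where "r = exp (- t)"
  have r: "0 < r" "r < 1" using t by (auto simp: r_def)
  \<comment> \<open>P and A are damping exponent and phase; the positive constant M is the
    generating function at r and does not affect the sign of the integral.\<close>
  define P where "P u = \<alpha> * (\<Sum>k. sigma_inv k * r ^ k * (1 - cos (real k * u)))" for u
  define A where "A u = \<alpha> * (\<Sum>k. sigma_inv k * r ^ k * sin (real k * u)) - real n * u" for u
  define F where "F = (\<lambda>u. exp (- P u) * cos (A u) * (1 - cos u))"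
  define M where "M = exp (\<alpha> * (\<Sum>k. sigma_inv k * r ^ k))"
  define g where "g u = Re (frac_partition_gf \<alpha> (of_real r * cis u) * cis (- (real n * u)))" for u
  have gF: "g u * (1 - cos u) = M * F u" for u
    unfolding g_def F_def M_def P_def A_def using r
    by (subst Re_frac_partition_gf_cis) (simp_all add: mult.assoc)
  have int: "F integrable_on {0..pi}"
  proof -
    have "continuous_on {0..pi} g"
      unfolding g_def using r
      by (intro continuous_intros continuous_on_compose2[OF holomorphic_on_imp_continuous_on[OF holomorphic_frac_partition_gf]])
         (auto simp: norm_mult)
    then have "continuous_on {0..pi} (\<lambda>u. g u * (1 - cos u) / M)"
      by (intro continuous_intros) (auto simp: M_def)
    moreover have "g u * (1 - cos u) / M = F u" for u
      by (simp add: gF M_def)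
    ultimately show ?thesis
      by (intro integrable_continuous_real) simp
  qed
  have "0 \<le> integral {0..pi} F"
    unfolding F_def
  proof (rule oscillatory_integral_nonneg[OF \<alpha> t t_le t70])
    show "P u \<le> 33 / 20 * \<alpha> * u ^ 2 / t ^ 3" for u
      using mult_left_mono[OF sigma_inv_cos_le[OF t, of u], of \<alpha>] \<alpha> by (simp add: P_def r_def mult_ac)
    show "\<alpha> / t * (v / (1 + v)) \<le> P u" if "v = (sin (u / 2) / sinh (t / 2)) ^ 2" for u v
      using mult_left_mono[OF sigma_inv_cos_ge[OF t, of u], of \<alpha>] \<alpha> by (simp add: P_def r_def that mult_ac)
    show "\<bar>A u\<bar> \<le> 77 / 40 * \<alpha> * u ^ 3 / t ^ 4" if "0 \<le> u" for u
    proof -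
      \<comment> \<open>The saddle equation identifies n u with the linear term of the phase
        sum.\<close>
      have "A u = \<alpha> * ((\<Sum>k. sigma_inv k * r ^ k * sin (real k * u)) - u * (\<Sum>k. real k * sigma_inv k * r ^ k))"
        unfolding A_def saddle[symmetric] by (simp add: r_def algebra_simps)
      then show ?thesis
        using mult_left_mono[OF sigma_inv_sin_le[OF t that], of \<alpha>] \<alpha> by (simp add: r_def abs_mult mult_ac)
    qed
  qed (use int in \<open>simp add: F_def\<close>)
  then have "0 \<le> integral {0..pi} (\<lambda>u. g u * (1 - cos u))"
    unfolding gF by (simp add: M_def)
  then show ?thesis
    unfolding g_def using \<alpha> r n0 by (intro log_concave_of_integral_nonneg) auto
qed

theorem corollary1p3:
  fixes \<alpha> :: real and n l :: nat
  assumes "\<alpha> \<ge> 2" and "\<alpha> \<noteq> 24"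
    and "n \<ge> 1" and "l \<ge> 1" and "n > l"
    and "(\<alpha>, n, l) \<noteq> (2, 6, 4)"
    and "real l \<ge> max (2 * \<alpha> ^ 11 + \<alpha> / 24) (100 / (\<alpha> - 24) + \<alpha> / 24)"
  shows "frac_partition \<alpha> (n - 1) * frac_partition \<alpha> (l + 1)
           \<ge> frac_partition \<alpha> n * frac_partition \<alpha> l"
proof -
  define p where "p = frac_partition \<alpha>"
  have pos: "p k > 0" for k
    using assms(1) by (simp add: p_def frac_partition_pos)
  have l: "real l \<ge> 2 * \<alpha> ^ 11"
    using assms(1,7) by simp
  \<comment> \<open>Log-concavity makes p(k+1)/p(k) nonincreasing from k = l on, so the ratio at l +
    d is at most the one at l; the theorem is the case d = n - l - 1. Each induction step uses
    log-concavity at l + d + 1 and cancels the positive p(l + d).\<close>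
  have "p (Suc l + d) * p l \<le> p (l + d) * p (Suc l)" for d
  proof (induction d)
    case (Suc d)
    let ?m = "l + Suc d"
    have "p (?m - 1) * p (?m + 1) \<le> p ?m ^ 2"
      unfolding p_def using l assms(1) by (intro frac_partition_log_concave) auto
    then have lc: "p (l + d) * p (Suc l + Suc d) \<le> p (Suc l + d) * p (l + Suc d)"
      by (simp add: power2_eq_square)
    have "p (l + d) * (p (Suc l + Suc d) * p l) \<le> p (Suc l + d) * p (l + Suc d) * p l"
      using mult_right_mono[OF lc, of "p l"] pos[of l] by (simp add: mult_ac)
    also have "\<dots> = p (l + Suc d) * (p (Suc l + d) * p l)"
      by (simp add: mult_ac)
    also have "\<dots> \<le> p (l + Suc d) * (p (l + d) * p (Suc l))"
      using Suc.IH pos[of "l + Suc d"] by (intro mult_left_mono) auto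
    also have "\<dots> = p (l + d) * (p (l + Suc d) * p (Suc l))"
      by (simp add: mult_ac)
    finally show ?case
      using pos[of "l + d"] by (simp only: mult_le_cancel_left_pos)
  qed simp
  from this[of "n - Suc l"] assms(5) show ?thesis
    by (simp add: p_def)
qed

end
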